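(* For all $s\ge1$, $$\left\{F\in\mathbb C_\infty[X_1,\dots,X_s]\ ;\ \mathfrak L(F,Z)\in\overline A[X_1,\dots,X_s][[Z]]\otimes_AK\right\}=A[X_1,\dots,X_s].$$
   Context: $\mathbb F_q$ is a finite field with $q$ elements, $A=\mathbb F_q[\theta]$, $K=\mathbb F_q(\theta)$, $A_{+,d}$ is the set of monic elements of degree $d$ of $A$. $\mathbb C_\infty$ is the completion of an algebraic closure of $\mathbb F_q((1/\theta))$, $\overline K$ is the algebraic closure of $K$ in $\mathbb C_\infty$, and $\overline A$ is the integral closure of $A$ in $\overline K$. The Carlitz module is the $\mathbb F_q$-algebra morphism $a\mapsto C_a$ from $A$ to $\mathbb F_q$-linear polynomials over $A$ (under composition) with $C_\theta(X)=\theta X+X^q$. $D_0=1$, $D_i=(\theta^{q^i}-\theta)D_{i-1}^q$ for $i\ge 1$, and $\exp_C(G)=\sum_{i\ge0}G^{q^i}/D_i$ for $G\in Z\,\mathbb C_\infty[X_1,\dots,X_s][[Z]]$. For $F\in\mathbb C_\infty[X_1,\dots,X_s]$, $$\mathfrak L(F,Z)=\exp_C\Big(\sum_{d\ge0}Z^{q^d}\sum_{a\in A_{+,d}}\frac{F(C_a(X_1),\dots,C_a(X_s))}{a}\Big)\in\mathbb C_\infty[X_1,\dots,X_s][[Z]].$$ The condition $G\in\overline A[X_1,\dots,X_s][[Z]]\otimes_AK$ means that there is $b\in A\setminus\{0\}$ with $bG\in\overline A[X_1,\dots,X_s][[Z]]$. *)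

theory Defs
  imports
    "HOL-Analysis.Analysis"
    "HOL-Algebra.Algebraic_Closure_Type"
    "HOL-Computational_Algebra.Computational_Algebra"
    "HOL-Library.Poly_Mapping"
begin

section \<open>The field of Carlitz complex numbers\<close>

text \<open>
  \<open>'q\<close> is the finite field with \<open>q = CARD('q)\<close> elements and \<open>A\<close> is the type \<open>'q poly\<close>.
  The local field \<open>\<bbbF>\<^sub>q((1/\<theta>))\<close> is \<open>'q fls\<close>, whose formal variable
  \<open>fls_X\<close> stands for \<open>1/\<theta>\<close>; thus \<open>\<theta>\<close> is \<open>fls_X_inv\<close>, and its absolute
  value, normalised by \<open>|\<theta>| = q\<close>, is \<open>|f| = q ^ (- fls_subdegree f)\<close>.

  The locale says that the field \<open>'c\<close>, with absolute value \<open>absC\<close>, is a completion of the algebraic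
  closure \<open>'q fls alg_closure\<close>: the map \<open>\<iota>\<close> is a field embedding with dense image, \<open>absC\<close>
  restricts to the given absolute value of \<open>\<bbbF>\<^sub>q((1/\<theta>))\<close>, and \<open>'c\<close> is complete.
  Since the absolute value of a complete field extends uniquely to its algebraic closure, this
  determines \<open>('c, absC, \<iota>)\<close> up to a unique isometric isomorphism.
\<close>
locale carlitz_complex =
  fixes absC :: "'c::field \<Rightarrow> real"
    and \<iota> :: "'q::finite_field fls alg_closure \<Rightarrow> 'c"
  assumes absC_nonneg: "absC x \<ge> 0"
    and absC_eq_0_iff: "absC x = 0 \<longleftrightarrow> x = 0"
    and absC_mult: "absC (x * y) = absC x * absC y"
    and absC_ultrametric: "absC (x + y) \<le> max (absC x) (absC y)"
    and \<iota>_one: "\<iota> 1 = 1"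
    and \<iota>_add: "\<iota> (u + w) = \<iota> u + \<iota> w"
    and \<iota>_mult: "\<iota> (u * w) = \<iota> u * \<iota> w"
    and absC_\<iota>_to_ac: "f \<noteq> 0 \<Longrightarrow>
          absC (\<iota> (to_ac f)) = real CARD('q) powi (- fls_subdegree f)"
    and \<iota>_dense: "e > 0 \<Longrightarrow> \<exists>u. absC (x - \<iota> u) < e"
    and absC_complete: "(\<And>e. e > 0 \<Longrightarrow> \<exists>N. \<forall>m\<ge>N. \<forall>n\<ge>N. absC (Y m - Y n) < e) \<Longrightarrow>
          \<exists>L. (\<lambda>n. absC (Y n - L)) \<longlonglongrightarrow> 0"

text \<open>The inclusions \<open>A \<subset> K \<subset> \<C>\<^sub>\<infinity>\<close>, and the subrings
  \<open>\<open>K\<close>-bar\<close> and \<open>\<open>A\<close>-bar\<close> of \<open>\<C>\<^sub>\<infinity>\<close>.\<close>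

definition theta :: "('q::finite_field fls alg_closure \<Rightarrow> 'c::field) \<Rightarrow> 'c" where
  "theta \<iota> = \<iota> (to_ac fls_X_inv)"

definition of_A :: "('q::finite_field fls alg_closure \<Rightarrow> 'c::field) \<Rightarrow> 'q poly \<Rightarrow> 'c" where
  "of_A \<iota> a = poly (map_poly (\<lambda>c. \<iota> (to_ac (fls_const c))) a) (theta \<iota>)"

definition K_in_C :: "('q::finite_field fls alg_closure \<Rightarrow> 'c::field) \<Rightarrow> 'c set" where
  "K_in_C \<iota> = {of_A \<iota> a / of_A \<iota> b | a b. b \<noteq> 0}"

definition Kbar :: "('q::finite_field fls alg_closure \<Rightarrow> 'c::field) \<Rightarrow> 'c set" where
  "Kbar \<iota> = {x. \<exists>p. p \<noteq> 0 \<and> (\<forall>i. Polynomial.coeff p i \<in> K_in_C \<iota>) \<and> poly p x = 0}"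

definition Abar :: "('q::finite_field fls alg_closure \<Rightarrow> 'c::field) \<Rightarrow> 'c set" where
  "Abar \<iota> = {x \<in> Kbar \<iota>. \<exists>p. Polynomial.lead_coeff p = 1 \<and>
     (\<forall>i. Polynomial.coeff p i \<in> range (of_A \<iota>)) \<and> poly p x = 0}"

section \<open>Multivariate polynomials\<close>

text \<open>
  A polynomial in variables \<open>X\<^sub>i\<close>, \<open>i :: nat\<close>, is a finitely supported family of
  coefficients indexed by monomials, and a monomial is a finitely supported family of exponents.
\<close>
type_synonym 'c mpoly = "(nat \<Rightarrow>\<^sub>0 nat) \<Rightarrow>\<^sub>0 'c"

definition mconst :: "'c::comm_ring_1 \<Rightarrow> 'c mpoly" where
  "mconst c = Poly_Mapping.single 0 c"

definition mvar :: "nat \<Rightarrow> 'c::comm_ring_1 mpoly" where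
  "mvar i = Poly_Mapping.single (Poly_Mapping.single i 1) 1"

text \<open>\<open>R[X\<^sub>1, \<dots>, X\<^sub>s]\<close> for a subset \<open>R\<close> of the coefficient ring.\<close>
definition mpolys :: "'c::comm_ring_1 set \<Rightarrow> nat \<Rightarrow> 'c mpoly set" where
  "mpolys R s = {F. (\<forall>m. Poly_Mapping.lookup F m \<in> R) \<and>
                    (\<forall>m\<in>Poly_Mapping.keys F. Poly_Mapping.keys m \<subseteq> {1..s})}"

text \<open>Substitution of \<open>g i\<close> for \<open>X\<^sub>i\<close>.\<close>
definition msubst :: "(nat \<Rightarrow> 'c mpoly) \<Rightarrow> 'c::comm_ring_1 mpoly \<Rightarrow> 'c mpoly" where
  "msubst g F = (\<Sum>m\<in>Poly_Mapping.keys F. mconst (Poly_Mapping.lookup F m) *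
                   (\<Prod>i\<in>Poly_Mapping.keys m. g i ^ Poly_Mapping.lookup m i))"

section \<open>The Carlitz module and the Carlitz exponential\<close>

text \<open>Polynomials in \<open>X\<close> over \<open>A\<close> have type \<open>'q poly poly\<close>, and composition is \<open>pcompose\<close>.\<close>

definition carlitz_theta :: "'q::finite_field poly poly" where
  "carlitz_theta = Polynomial.monom [:0, 1:] 1 + Polynomial.monom 1 CARD('q)"

text \<open>
  The image of \<open>a\<close> under the morphism is computed by Horner's scheme, that is, from
  \<open>C\<^sub>c\<^sub>+\<^sub>\<theta>\<^sub>a(X) = c X + C\<^sub>\<theta>(C\<^sub>a(X))\<close> for \<open>c \<in> \<bbbF>\<^sub>q\<close>. The lemmas below check that this
  is the \<open>\<bbbF>\<^sub>q\<close>-algebra morphism into \<open>\<bbbF>\<^sub>q\<close>-linear polynomials with the given value at \<open>\<theta>\<close>.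
\<close>
definition carlitz :: "'q::finite_field poly \<Rightarrow> 'q poly poly" where
  "carlitz a = fold_coeffs (\<lambda>c P. Polynomial.smult [:c:] [:0, 1:] + pcompose carlitz_theta P) a 0"

lemma carlitz_0 [simp]: "carlitz 0 = 0"
  by (simp add: carlitz_def)

lemma carlitz_pCons:
  "carlitz (pCons c a) = Polynomial.smult [:c:] [:0, 1:] + pcompose carlitz_theta (carlitz a)"
proof -
  have "pcompose (carlitz_theta :: 'a poly poly) 0 = 0"
    by (simp add: carlitz_theta_def pcompose_0' Polynomial.coeff_monom)
  then show ?thesis
    by (cases "c = 0 \<and> a = 0") (auto simp: carlitz_def)
qed

lemma of_nat_card_choose_eq_0:
  assumes "0 < k" "k < CARD('q)"
  shows "of_nat (CARD('q) choose k) = (0 :: 'q::finite_field)"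
proof -
  let ?q = "CARD('q)"
  define f :: "'q poly" where "f = [:1, 1:] ^ ?q - Polynomial.monom 1 ?q - 1"
  have q: "?q > 0" by simp
  have co: "Polynomial.coeff ([:1, 1:] ^ ?q :: 'q poly) i = of_nat (?q choose i)"
    if "i \<le> ?q" for i
    using coeff_linear_poly_power[OF that, of 1 1] by simp
  have "f = 0"
  proof (rule ccontr)
    assume "f \<noteq> 0"
    have "Polynomial.degree f \<le> ?q"
    proof -
      have "Polynomial.degree ([:1, 1:] ^ ?q :: 'q poly) \<le> ?q"
        by (metis degree_linear_power order_refl)
      then show ?thesis
        unfolding f_def by (intro Polynomial.degree_diff_le) (auto simp: Polynomial.degree_monom_le)
    qed
    moreover have "Polynomial.coeff f ?q = 0"
      using q unfolding f_def by (simp add: co Polynomial.coeff_monom)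
    ultimately have "Polynomial.degree f < ?q"
      using \<open>f \<noteq> 0\<close> by (metis leading_coeff_0_iff le_neq_implies_less)
    moreover have "{x. poly f x = 0} = UNIV"
      unfolding f_def
      by (auto simp: poly_monom finite_field_power_card_eq_same)
    then have "CARD('q) \<le> Polynomial.degree f"
      using card_poly_roots_bound[OF \<open>f \<noteq> 0\<close>] by simp
    ultimately show False by simp
  qed
  then have "Polynomial.coeff f k = 0" by simp
  then show ?thesis
    using assms unfolding f_def by (simp add: co Polynomial.coeff_monom)
qed

lemma power_card_add:
  fixes P Q :: "'q::finite_field poly poly"
  shows "(P + Q) ^ CARD('q) = P ^ CARD('q) + Q ^ CARD('q)"
proof -
  let ?q = "CARD('q)"
  have z: "of_nat (?q choose k) = (0 :: 'q poly poly)" if "0 < k" "k < ?q" for k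
    using of_nat_card_choose_eq_0[where ?'q = 'q, OF that] by (simp add: of_nat_poly)
  have "(P + Q) ^ ?q = (\<Sum>k\<le>?q. of_nat (?q choose k) * P ^ k * Q ^ (?q - k))"
    by (rule binomial_ring)
  also have "\<dots> = (\<Sum>k\<in>{0, ?q}. of_nat (?q choose k) * P ^ k * Q ^ (?q - k))"
    by (rule sum.mono_neutral_right) (auto simp: z)
  also have "\<dots> = P ^ ?q + Q ^ ?q"
    by simp
  finally show ?thesis .
qed

lemma pcompose_carlitz_theta:
  "pcompose carlitz_theta P = Polynomial.smult [:0, 1:] P + (P :: 'q::finite_field poly poly) ^ CARD('q)"
proof -
  have "pcompose (Polynomial.monom 1 n) P = P ^ n" for n
    by (induction n) (simp_all add: Polynomial.monom_Suc pcompose_pCons pcompose_1)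
  moreover have "pcompose (Polynomial.monom [:0, 1:] 1) P = Polynomial.smult [:0, 1:] P"
    by (simp add: Polynomial.monom_Suc Polynomial.monom_0 pcompose_pCons)
  ultimately show ?thesis
    by (simp only: carlitz_theta_def pcompose_add)
qed

lemma pcompose_carlitz_theta_add:
  "pcompose carlitz_theta (P + Q) = pcompose carlitz_theta P + pcompose carlitz_theta Q"
  by (simp add: pcompose_carlitz_theta power_card_add smult_add_right)

lemma pcompose_carlitz_theta_smult:
  "pcompose carlitz_theta (Polynomial.smult [:c:] P) = Polynomial.smult [:c:] (pcompose carlitz_theta P)"
  for c :: "'q::finite_field"
proof -
  have "[:c:] ^ CARD('q) = [:c:]"
    by (simp add: poly_const_pow finite_field_power_card_eq_same)
  then have "Polynomial.smult [:c:] P ^ CARD('q) = Polynomial.smult [:c:] (P ^ CARD('q))"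
    by (simp only: smult_power)
  then show ?thesis
    by (simp add: pcompose_carlitz_theta smult_add_right mult.commute)
qed

lemma carlitz_add: "carlitz (a + b) = carlitz a + carlitz b"
  by (induction a b rule: poly_induct2)
     (simp_all add: carlitz_pCons pcompose_carlitz_theta_add algebra_simps)

lemma carlitz_smult: "carlitz (Polynomial.smult c a) = Polynomial.smult [:c:] (carlitz a)"
  by (induction a)
     (simp_all add: carlitz_pCons pcompose_carlitz_theta_smult smult_add_right)

lemma carlitz_1: "carlitz 1 = [:0, 1:]"
  by (simp add: one_pCons carlitz_pCons pcompose_carlitz_theta)

lemma carlitz_mult: "carlitz (a * b) = pcompose (carlitz a) (carlitz b)"
  by (induction a)
     (simp_all add: carlitz_pCons carlitz_add carlitz_smult pcompose_add pcompose_smult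
       pcompose_assoc pcompose_pCons)

lemma carlitz_at_theta: "carlitz [:0, 1:] = carlitz_theta"
  using carlitz_pCons[of 0 1] unfolding carlitz_1 pcompose_idR by (simp add: one_pCons)

lemma pcompose_carlitz_add:
  "pcompose (carlitz a) (P + Q) = pcompose (carlitz a) P + pcompose (carlitz a) Q"
  by (induction a)
     (simp_all add: carlitz_pCons pcompose_add pcompose_pCons pcompose_carlitz_theta_add
       smult_add_right flip: pcompose_assoc)

lemma pcompose_carlitz_smult:
  "pcompose (carlitz a) (Polynomial.smult [:c:] P) = Polynomial.smult [:c:] (pcompose (carlitz a) P)"
  by (induction a)
     (simp_all add: carlitz_pCons pcompose_add pcompose_pCons pcompose_carlitz_theta_smult
       smult_add_right mult.commute flip: pcompose_assoc)

text \<open>\<open>C\<^sub>a(X\<^sub>i)\<close> in \<open>\<C>\<^sub>\<infinity>[X\<^sub>1, \<dots>, X\<^sub>s]\<close>.\<close>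
definition carlitz_var ::
    "('q::finite_field fls alg_closure \<Rightarrow> 'c::field) \<Rightarrow> 'q poly \<Rightarrow> nat \<Rightarrow> 'c mpoly" where
  "carlitz_var \<iota> a i = poly (map_poly (\<lambda>b. mconst (of_A \<iota> b)) (carlitz a)) (mvar i)"

primrec carlitz_D :: "nat \<Rightarrow> 'q::finite_field poly" where
  "carlitz_D 0 = 1"
| "carlitz_D (Suc i) =
     (Polynomial.monom 1 (CARD('q) ^ Suc i) - Polynomial.monom 1 1) * carlitz_D i ^ CARD('q)"

text \<open>
  The infinite sums are written with \<open>suminf\<close> because \<open>\<Sum>i. _\<close> is also the notation of
  \<open>Sum_any\<close>. They are taken in the \<open>Z\<close>-adic topology of the power series ring. The one in
  \<open>carlitz_exp\<close> converges for \<open>G\<close> with zero constant term, as is the case in \<open>carlitz_L\<close>.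
\<close>
definition carlitz_exp ::
    "('q::finite_field fls alg_closure \<Rightarrow> 'c::field) \<Rightarrow> 'c mpoly fps \<Rightarrow> 'c mpoly fps" where
  "carlitz_exp \<iota> G =
     suminf (\<lambda>i. fps_const (mconst (inverse (of_A \<iota> (carlitz_D i)))) * G ^ (CARD('q) ^ i))"

definition monic_of_degree :: "nat \<Rightarrow> 'q::finite_field poly set" where
  "monic_of_degree d = {a. Polynomial.lead_coeff a = 1 \<and> Polynomial.degree a = d}"

definition carlitz_L ::
    "('q::finite_field fls alg_closure \<Rightarrow> 'c::field) \<Rightarrow> 'c mpoly \<Rightarrow> 'c mpoly fps" where
  "carlitz_L \<iota> F = carlitz_exp \<iota>
     (suminf (\<lambda>d. fps_X ^ (CARD('q) ^ d) *
        fps_const (\<Sum>a\<in>monic_of_degree d.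
          mconst (inverse (of_A \<iota> a)) * msubst (carlitz_var \<iota> a) F)))"

text \<open>\<open>\<open>A\<close>-bar[X\<^sub>1, \<dots>, X\<^sub>s][[Z]] \<otimes>\<^sub>A K\<close>, as a subset of \<open>\<C>\<^sub>\<infinity>[X\<^sub>1, \<dots>, X\<^sub>s][[Z]]\<close>.\<close>
definition Abar_fps_tensor_K ::
    "('q::finite_field fls alg_closure \<Rightarrow> 'c::field) \<Rightarrow> nat \<Rightarrow> 'c mpoly fps set" where
  "Abar_fps_tensor_K \<iota> s =
     {G. \<exists>b. b \<noteq> 0 \<and>
        (\<forall>n. fps_nth (fps_const (mconst (of_A \<iota> b)) * G) n \<in> mpolys (Abar \<iota>) s)}"

end

theory Submission
  imports Defs
begin

text \<open>
  Write \<open>L_coeff F n = E\<^sub>n(F) = \<Sum>\<^sub>i S\<^sub>n\<^sub>-\<^sub>i(F)^(q^i) / D\<^sub>i\<close>, where \<open>carlitz_sum F d = S\<^sub>d(F)\<close> is the sum of \<open>F(C\<^sub>a(X)) / a\<close> over the monic \<open>a\<close> of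
  degree \<open>d\<close>. Raising to the power \<open>q\<close> is additive, so \<open>E\<^sub>n(F)\<close> is the coefficient of \<open>Z^(q^n)\<close> in
  \<open>\<LL>(F, Z)\<close>, and all other coefficients vanish. Both inclusions are statements about the \<open>E\<^sub>n(F)\<close>.

  If \<open>F\<close> has coefficients in \<open>A\<close>, then so has every \<open>E\<^sub>n(F)\<close> (\<open>L_coeff_integral\<close>). It suffices to
  show integrality at each monic prime \<open>P\<close>, say of degree \<open>d\<close>. The substitution \<open>\<phi>: X\<^sub>i \<mapsto> C\<^sub>P(X\<^sub>i)\<close>
  is a lift of the \<open>q^d\<close>-power Frobenius modulo \<open>P\<close>, and separating the monic \<open>a\<close> that are divisible
  by \<open>P\<close> gives \<open>P S\<^sub>k = P u\<^sub>k + \<phi>(S\<^sub>k\<^sub>-\<^sub>d)\<close> with \<open>u\<^sub>k\<close> integral at \<open>P\<close>. Applying \<open>exp\<^sub>C\<close>, which turns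
  multiplication by \<open>P\<close> into \<open>C\<^sub>P\<close>, one finds that \<open>P E\<^sub>n(F)\<close> equals \<open>\<phi>(E\<^sub>n\<^sub>-\<^sub>d(F)) - E\<^sub>n\<^sub>-\<^sub>d(F)^(q^d)\<close>
  up to multiples of \<open>P\<close>, and the Frobenius property lets one divide by \<open>P\<close>. This is a Dwork type
  induction on \<open>n\<close> (\<open>L_coeff_local\<close>).

  Conversely, suppose \<open>b E\<^sub>n(F)\<close> is integral over \<open>A\<close> for all \<open>n\<close>. Let \<open>X^m\<close> be a monomial of
  largest total degree in \<open>F\<close> and \<open>f\<close> its coefficient. As \<open>C\<^sub>a(X)\<close> has leading term \<open>X^(q^d)\<close> for
  monic \<open>a\<close> of degree \<open>d\<close>, no other monomial of \<open>F\<close> contributes to \<open>X^(q^n m)\<close> in \<open>E\<^sub>n(F)\<close>, and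
  the coefficient there is \<open>\<Sum>\<^sub>i f^(q^i) / (D\<^sub>i \<ell>\<^sub>n\<^sub>-\<^sub>i^(q^i))\<close> with \<open>1/\<ell>\<^sub>d = \<Sum>\<^sub>a 1/a\<close>
  (\<open>lookup_L_coeff_leading\<close>). This is Carlitz's binomial polynomial
  \<open>\<psi>\<^sub>n(f) = \<Prod>(f - a) / D\<^sub>n\<close>, the product being over all \<open>a\<close> of degree less than \<open>n\<close>
  (\<open>psi_factorization\<close>). For large \<open>n\<close> the factors have size at most \<open>q^(n-1)\<close>, while \<open>|D\<^sub>n| = q^(n q^n)\<close>; so
  \<open>b \<psi>\<^sub>n(f)\<close> is integral over \<open>A\<close> and tends to \<open>0\<close> together with its conjugates. Hence it is \<open>0\<close> for
  large \<open>n\<close>, and \<open>f\<close> is one of the \<open>a\<close> (\<open>integral_psi_imp_A\<close>). Now subtract \<open>f X^m\<close>, for which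
  the first part applies, and use induction on the number of monomials of \<open>F\<close>.
\<close>

section \<open>Additivity of the \<open>q\<close>-power map\<close>

text \<open>
  This is the form in which characteristic \<open>p\<close> enters: it passes from \<open>\<bbbF>\<^sub>q\<close> to all the polynomial
  and power series rings below, and makes \<open>x \<mapsto> x^(q^n)\<close> additive.
\<close>
definition q_power_additive :: "'a::comm_ring_1 itself \<Rightarrow> nat \<Rightarrow> bool" where
  "q_power_additive R q \<longleftrightarrow> q > 0 \<and> (\<forall>k. 0 < k \<and> k < q \<longrightarrow> of_nat (q choose k) = (0 :: 'a))"

lemma q_power_add:
  assumes "q_power_additive TYPE('a::comm_ring_1) q"
  shows "(x + y :: 'a) ^ (q ^ n) = x ^ (q ^ n) + y ^ (q ^ n)"
proof (induction n)
  case (Suc n)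
  have add: "(x + y) ^ q = x ^ q + y ^ q" for x y :: 'a
  proof -
    have "(x + y) ^ q = (\<Sum>k\<le>q. of_nat (q choose k) * x ^ k * y ^ (q - k))"
      by (rule binomial_ring)
    also have "\<dots> = (\<Sum>k\<in>{0, q}. of_nat (q choose k) * x ^ k * y ^ (q - k))"
      by (rule sum.mono_neutral_right) (use assms in \<open>auto simp: q_power_additive_def\<close>)
    also have "\<dots> = x ^ q + y ^ q"
      using assms by (simp add: q_power_additive_def)
    finally show ?thesis .
  qed
  have "(x + y) ^ (q ^ Suc n) = ((x + y) ^ (q ^ n)) ^ q"
    by (simp add: power_mult mult.commute flip: power_mult)
  also have "\<dots> = x ^ (q ^ Suc n) + y ^ (q ^ Suc n)"
    by (simp add: Suc.IH add mult.commute flip: power_mult)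
  finally show ?case .
qed simp

lemma q_power_sum:
  assumes "q_power_additive TYPE('a::comm_ring_1) q"
  shows "(\<Sum>i\<in>I. f i :: 'a) ^ (q ^ n) = (\<Sum>i\<in>I. f i ^ (q ^ n))"
  using assms
  by (induction I rule: infinite_finite_induct)
     (auto simp: q_power_add zero_power q_power_additive_def)

lemma q_power_diff:
  assumes "q_power_additive TYPE('a::comm_ring_1) q"
  shows "(x - y :: 'a) ^ (q ^ n) = x ^ (q ^ n) - y ^ (q ^ n)"
  using q_power_add[OF assms, of "x - y" y n] by (simp add: eq_diff_eq)

lemma q_power_add1:
  assumes "q_power_additive TYPE('a::comm_ring_1) q"
  shows "(x + y :: 'a) ^ q = x ^ q + y ^ q"
  using q_power_add[OF assms, of x y 1] by simp

lemma q_power_sum1: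
  assumes "q_power_additive TYPE('a::comm_ring_1) q"
  shows "(\<Sum>i\<in>I. f i :: 'a) ^ q = (\<Sum>i\<in>I. f i ^ q)"
  using q_power_sum[OF assms, of f I 1] by simp

lemma q_power_diff1:
  assumes "q_power_additive TYPE('a::comm_ring_1) q"
  shows "(x - y :: 'a) ^ q = x ^ q - y ^ q"
  using q_power_diff[OF assms, of x y 1] by simp

lemma q_power_additive_poly:
  "q_power_additive TYPE('a::comm_ring_1) q \<Longrightarrow> q_power_additive TYPE('a poly) q"
  by (auto simp: q_power_additive_def of_nat_poly)

lemma q_power_additive_fps:
  "q_power_additive TYPE('a::comm_ring_1) q \<Longrightarrow> q_power_additive TYPE('a fps) q"
  by (auto simp: q_power_additive_def simp flip: fps_of_nat)

lemma q_power_additive_mpoly: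
  "q_power_additive TYPE('a::comm_ring_1) q \<Longrightarrow> q_power_additive TYPE('a mpoly) q"
  by (auto simp: q_power_additive_def simp flip: Poly_Mapping.single_of_nat)

lemma q_power_additive_finite_field: "q_power_additive TYPE('q::finite_field) CARD('q)"
  using of_nat_card_choose_eq_0[where ?'q = 'q] by (auto simp: q_power_additive_def)

section \<open>The embedding of \<open>A\<close> and its absolute value\<close>

text \<open>
  \<open>CARD('q)\<close> depends on the type \<open>'q\<close> alone, hence \<open>q\<close> is a variable that is fixed by an equation.
\<close>
locale carlitz_complex_q = carlitz_complex absC \<iota>
  for absC :: "'c::field \<Rightarrow> real" and \<iota> :: "'q::finite_field fls alg_closure \<Rightarrow> 'c" +
  fixes q :: nat
  assumes card_q [simp]: "CARD('q) = q"
begin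

abbreviation oA :: "'q poly \<Rightarrow> 'c" where "oA \<equiv> of_A \<iota>"

abbreviation \<theta> :: 'c where "\<theta> \<equiv> theta \<iota>"

abbreviation const_C :: "'q \<Rightarrow> 'c" where "const_C c \<equiv> \<iota> (to_ac (fls_const c))"

abbreviation DC :: "nat \<Rightarrow> 'c" where "DC i \<equiv> oA (carlitz_D i)"

lemma q_ge_2: "q \<ge> 2"
proof -
  have "card {0, 1 :: 'q} \<le> CARD('q)" by (rule card_mono) auto
  then show ?thesis by simp
qed

lemma q_pos [simp]: "q > 0"
  using q_ge_2 by simp

lemma \<iota>_0 [simp]: "\<iota> 0 = 0"
proof -
  have "\<iota> 0 = \<iota> 0 + \<iota> 0" using \<iota>_add[of 0 0] by (simp only: add_0_left)
  then show ?thesis by (rule iffD1[OF add_cancel_right_right])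
qed

lemma const_C_0 [simp]: "const_C 0 = 0"
  by simp

lemma const_C_1 [simp]: "const_C 1 = 1"
  by (simp add: \<iota>_one)

lemma const_C_add: "const_C (c + d) = const_C c + const_C d"
proof -
  have "fls_const (c + d) = fls_const c + fls_const d" by (rule fls_eqI) auto
  then show ?thesis by (simp add: \<iota>_add)
qed

lemma const_C_mult: "const_C (c * d) = const_C c * const_C d"
  by (simp add: \<iota>_mult flip: fls_const_mult_const)

lemma const_C_power: "const_C (c ^ n) = const_C c ^ n"
  by (induction n) (simp_all only: power_0 power_Suc const_C_1 const_C_mult)

lemma const_C_power_q: "const_C c ^ (q ^ n) = const_C c"
  by (simp only: const_C_power[symmetric] card_q[symmetric] finite_field_power_card_power_eq_same)

lemma oA_0 [simp]: "oA 0 = 0"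
  by (simp add: of_A_def)

lemma oA_pCons: "oA (pCons c a) = const_C c + \<theta> * oA a"
  by (simp add: of_A_def map_poly_pCons)

lemma oA_const [simp]: "oA [:c:] = const_C c"
  by (simp add: oA_pCons)

lemma oA_1 [simp]: "oA 1 = 1"
  by (simp only: one_pCons oA_const const_C_1)

lemma oA_add: "oA (a + b) = oA a + oA b"
  by (induction a b rule: poly_induct2)
     (simp_all add: oA_pCons const_C_add algebra_simps del: oA_const)

lemma oA_smult: "oA (Polynomial.smult c a) = const_C c * oA a"
  by (induction a) (simp_all add: oA_pCons const_C_mult algebra_simps)

lemma oA_mult: "oA (a * b) = oA a * oA b"
  by (induction a) (simp_all add: oA_pCons oA_add oA_smult algebra_simps)

lemma oA_power: "oA (a ^ n) = oA a ^ n"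
  by (induction n) (simp_all add: oA_mult)

lemma oA_uminus: "oA (- a) = - oA a"
  using oA_add[of a "- a"] by (simp add: add_eq_0_iff)

lemma oA_diff: "oA (a - b) = oA a - oA b"
  using oA_add[of a "- b"] by (simp add: oA_uminus)

lemma oA_prod: "oA (\<Prod>i\<in>I. f i) = (\<Prod>i\<in>I. oA (f i))"
  by (induction I rule: infinite_finite_induct) (simp_all add: oA_mult)

lemma oA_of_nat: "oA (of_nat n) = of_nat n"
  by (induction n) (simp_all add: oA_add)

lemma oA_X: "oA [:0, 1:] = \<theta>"
  by (simp add: oA_pCons \<iota>_one)

lemma oA_monom_1: "oA (Polynomial.monom 1 n) = \<theta> ^ n"
  by (simp add: monom_altdef oA_smult oA_power oA_X \<iota>_one)

lemma absC_0 [simp]: "absC 0 = 0"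
  by (simp add: absC_eq_0_iff)

lemma absC_pos: "x \<noteq> 0 \<Longrightarrow> absC x > 0"
  using absC_nonneg[of x] absC_eq_0_iff[of x] by linarith

lemma absC_1 [simp]: "absC 1 = 1"
  using absC_mult[of 1 1] absC_eq_0_iff[of 1] by simp

lemma absC_minus [simp]: "absC (- x) = absC x"
proof -
  have "absC (-1) * absC (-1) = 1"
    using absC_mult[of "-1" "-1"] by simp
  then have "absC (-1) = 1"
    using absC_nonneg[of "-1"] by (metis abs_of_nonneg abs_1 power2_eq_square power2_eq_1_iff abs_square_eq_1)
  then show ?thesis
    using absC_mult[of "-1" x] by simp
qed

lemma absC_prod: "absC (\<Prod>i\<in>I. f i) = (\<Prod>i\<in>I. absC (f i))"
  by (induction I rule: infinite_finite_induct) (simp_all add: absC_mult)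

lemma absC_diff_le: "absC (x - y) \<le> max (absC x) (absC y)"
  using absC_ultrametric[of x "- y"] by simp

lemma absC_divide: "absC (x / y) = absC x / absC y"
proof (cases "y = 0")
  case False
  then have "absC (x / y) * absC y = absC x"
    using absC_mult[of "x / y" y] by simp
  then show ?thesis
    using False absC_eq_0_iff[of y] by (simp add: eq_divide_eq)
qed simp

lemma absC_dominant:
  assumes "absC x < absC y"
  shows "absC (x + y) = absC y"
proof (rule antisym)
  show "absC (x + y) \<le> absC y"
    using absC_ultrametric[of x y] assms by simp
  show "absC y \<le> absC (x + y)"
    using absC_diff_le[of "x + y" x] assms by (simp add: le_max_iff_disj)
qed

lemma absC_const_C: "c \<noteq> 0 \<Longrightarrow> absC (const_C c) = 1"
  by (subst absC_\<iota>_to_ac) auto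

lemma absC_theta: "absC \<theta> = q"
  by (simp add: theta_def absC_\<iota>_to_ac)

lemma absC_oA: "a \<noteq> 0 \<Longrightarrow> absC (oA a) = real q ^ Polynomial.degree a"
proof (induction a)
  case (pCons c a)
  show ?case
  proof (cases "a = 0")
    case True
    then show ?thesis using pCons by (simp add: absC_const_C)
  next
    case False
    have "absC (const_C c) \<le> 1"
      using absC_const_C[of c] by (cases "c = 0") auto
    also have "1 < real q ^ Suc (Polynomial.degree a)"
      using q_ge_2 by (intro one_less_power) auto
    also have "\<dots> = absC (\<theta> * oA a)"
      using False pCons by (simp add: absC_mult absC_theta)
    finally show ?thesis
      using absC_dominant False pCons by (simp add: oA_pCons absC_mult absC_theta)
  qed
qed simp

lemma oA_eq_0_iff [simp]: "oA a = 0 \<longleftrightarrow> a = 0"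
proof
  assume "oA a = 0"
  then have "absC (oA a) = 0" by simp
  then show "a = 0"
    using absC_oA[of a] q_pos by (metis power_not_zero of_nat_eq_0_iff less_irrefl)
qed simp

lemma oA_eq_iff [simp]: "oA a = oA b \<longleftrightarrow> a = b"
  using oA_eq_0_iff[of "a - b"] by (simp add: oA_diff)

lemma inj_on_oA: "inj_on oA S"
  by (auto simp: inj_on_def)

lemma q_power_additive_A: "q_power_additive TYPE('q poly) q"
  using q_power_additive_poly[OF q_power_additive_finite_field[where ?'q = 'q]] by simp

lemma q_power_additive_C: "q_power_additive TYPE('c) q"
proof -
  have "of_nat (q choose k) = (0 :: 'c)" if "0 < k" "k < q" for k
  proof -
    have "of_nat (q choose k) = (0 :: 'q poly)"
      using q_power_additive_A that by (auto simp: q_power_additive_def)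
    then show ?thesis by (metis oA_of_nat oA_0)
  qed
  then show ?thesis by (auto simp: q_power_additive_def)
qed

lemma q_power_additive_MP: "q_power_additive TYPE('c mpoly) q"
  by (intro q_power_additive_mpoly q_power_additive_C)

lemmas q_power_C = q_power_add[OF q_power_additive_C] q_power_sum[OF q_power_additive_C]
  q_power_diff[OF q_power_additive_C]
lemmas q_power_C1 = q_power_add1[OF q_power_additive_C] q_power_sum1[OF q_power_additive_C]
  q_power_diff1[OF q_power_additive_C]
lemmas q_power_MP = q_power_add[OF q_power_additive_MP] q_power_sum[OF q_power_additive_MP]
  q_power_diff[OF q_power_additive_MP]
lemmas q_power_MP1 = q_power_add1[OF q_power_additive_MP] q_power_sum1[OF q_power_additive_MP]
  q_power_diff1[OF q_power_additive_MP]

section \<open>The Carlitz polynomials\<close>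

declare carlitz_D.simps(2) [simp del]

lemma theta_power_neq: "n \<noteq> m \<Longrightarrow> \<theta> ^ n \<noteq> \<theta> ^ m"
  using oA_eq_iff[of "Polynomial.monom 1 n" "Polynomial.monom 1 m"]
  by (simp add: oA_monom_1 monom_eq_iff')

lemma q_power_neq_1: "i > 0 \<Longrightarrow> q ^ i \<noteq> 1"
  using one_less_power[of q i] q_ge_2 by auto

lemma theta_q_power_neq: "i > 0 \<Longrightarrow> \<theta> ^ (q ^ i) \<noteq> \<theta>"
  using theta_power_neq[of "q ^ i" 1] q_power_neq_1[of i] by auto

lemma DC_Suc: "DC (Suc i) = (\<theta> ^ (q ^ Suc i) - \<theta>) * DC i ^ q"
  by (simp add: carlitz_D.simps oA_mult oA_diff oA_monom_1 oA_power)

lemma DC_nonzero [simp]: "DC i \<noteq> 0"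
proof (induction i)
  case (Suc i)
  then show ?case
    using theta_q_power_neq[of "Suc i"] unfolding DC_Suc by auto
qed simp

lemma carlitz_D_nonzero [simp]: "(carlitz_D i :: 'q poly) \<noteq> 0"
  using DC_nonzero[of i] by auto

text \<open>
  \<open>log\<^sub>C(Z) = \<Sum> Z^(q^n) / \<ell>\<^sub>n\<close> is the Carlitz logarithm, the inverse of \<open>exp\<^sub>C\<close>.
\<close>
definition ell :: "nat \<Rightarrow> 'c" where
  "ell n = (\<Prod>j=1..n. \<theta> - \<theta> ^ (q ^ j))"

lemma ell_0 [simp]: "ell 0 = 1"
  by (simp add: ell_def)

lemma ell_Suc: "ell (Suc n) = ell n * (\<theta> - \<theta> ^ (q ^ Suc n))"
  by (simp add: ell_def)

lemma ell_nonzero [simp]: "ell n \<noteq> 0"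
proof -
  have "\<theta> - \<theta> ^ (q ^ j) \<noteq> 0" if "j \<in> {1..n}" for j
    using theta_q_power_neq[of j] that by auto
  then show ?thesis by (simp add: ell_def)
qed

text \<open>
  The coefficient of \<open>Z^(q^n)\<close> in \<open>exp\<^sub>C(x log\<^sub>C(Z))\<close>. For \<open>x = a \<in> A\<close> that series is \<open>C\<^sub>a(Z)\<close>, so
  these are interpolations of the coefficients of the Carlitz module.
\<close>
definition psi :: "nat \<Rightarrow> 'c \<Rightarrow> 'c" where
  "psi n x = (\<Sum>i\<le>n. x ^ (q ^ i) / (DC i * ell (n - i) ^ (q ^ i)))"

lemma psi_0 [simp]: "psi 0 x = x"
  by (simp add: psi_def)

lemma psi_add: "psi n (x + y) = psi n x + psi n y"
  by (simp add: psi_def q_power_C add_divide_distrib sum.distrib)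

lemma psi_const_mult: "psi n (const_C c * x) = const_C c * psi n x"
  by (simp add: psi_def power_mult_distrib const_C_power_q sum_distrib_left)

text \<open>
  The functional equation \<open>exp\<^sub>C(\<theta> Y) = \<theta> exp\<^sub>C(Y) + exp\<^sub>C(Y)^q\<close>, in the form
  \<open>\<theta>^(q^i) / D\<^sub>i = \<theta> / D\<^sub>i + 1 / D\<^sub>i\<^sub>-\<^sub>1^q\<close>.
\<close>
lemma psi_theta_mult: "psi (Suc n) (\<theta> * x) = \<theta> * psi (Suc n) x + psi n x ^ q"
proof -
  have t: "(\<theta> * x) ^ (q ^ Suc i) / (DC (Suc i) * ell (n - i) ^ (q ^ Suc i)) =
      \<theta> * (x ^ (q ^ Suc i) / (DC (Suc i) * ell (n - i) ^ (q ^ Suc i)))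
       + (x ^ (q ^ i) / (DC i * ell (n - i) ^ (q ^ i))) ^ q" for i
  proof -
    have "(x ^ (q ^ i) / (DC i * ell (n - i) ^ (q ^ i))) ^ q =
       x ^ (q ^ Suc i) / (DC i ^ q * ell (n - i) ^ (q ^ Suc i))"
      by (simp add: power_divide power_mult_distrib mult.commute flip: power_mult)
    also have "\<dots> = (\<theta> ^ (q ^ Suc i) - \<theta>) * x ^ (q ^ Suc i) / (DC (Suc i) * ell (n - i) ^ (q ^ Suc i))"
      using theta_q_power_neq[of "Suc i"]
      unfolding DC_Suc by (simp add: divide_simps)
    finally show ?thesis
      by (simp add: power_mult_distrib diff_divide_distrib left_diff_distrib)
  qed
  have s: "psi (Suc n) y = y / ell (Suc n) +
      (\<Sum>i\<le>n. y ^ (q ^ Suc i) / (DC (Suc i) * ell (n - i) ^ (q ^ Suc i)))" for y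
    unfolding psi_def by (subst sum.atMost_Suc_shift) simp
  show ?thesis
    unfolding s t sum.distrib sum_distrib_left[symmetric]
    by (simp add: psi_def q_power_C1 algebra_simps)
qed

text \<open>
  The functional equation \<open>\<theta> log\<^sub>C(Z) = log\<^sub>C(\<theta> Z + Z^q)\<close>, in the form
  \<open>\<theta> / \<ell>\<^sub>k = \<theta>^(q^k) / \<ell>\<^sub>k + 1 / \<ell>\<^sub>k\<^sub>-\<^sub>1\<close>.
\<close>
lemma psi_theta_mult': "psi (Suc n) (\<theta> * x) = \<theta> ^ (q ^ Suc n) * psi (Suc n) x + psi n x"
proof -
  have t: "(\<theta> * x) ^ (q ^ i) / (DC i * ell (Suc n - i) ^ (q ^ i)) =
      \<theta> ^ (q ^ Suc n) * (x ^ (q ^ i) / (DC i * ell (Suc n - i) ^ (q ^ i)))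
       + x ^ (q ^ i) / (DC i * ell (n - i) ^ (q ^ i))" if "i \<le> n" for i
  proof -
    have e: "ell (Suc n - i) ^ (q ^ i) = ell (n - i) ^ (q ^ i) * (\<theta> ^ (q ^ i) - \<theta> ^ (q ^ Suc n))"
      using that by (simp add: Suc_diff_le ell_Suc power_mult_distrib q_power_C
           flip: power_mult power_add power_Suc)
    have "\<theta> ^ (q ^ i) - \<theta> ^ (q ^ Suc n) \<noteq> 0"
      using e ell_nonzero[of "Suc n - i"] by auto
    then show ?thesis
      unfolding e by (simp add: power_mult_distrib divide_simps) (simp add: algebra_simps)
  qed
  have "psi (Suc n) (\<theta> * x) = (\<Sum>i\<le>n. (\<theta> * x) ^ (q ^ i) / (DC i * ell (Suc n - i) ^ (q ^ i)))
      + (\<theta> * x) ^ (q ^ Suc n) / DC (Suc n)"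
    by (simp add: psi_def)
  also have "(\<Sum>i\<le>n. (\<theta> * x) ^ (q ^ i) / (DC i * ell (Suc n - i) ^ (q ^ i))) =
      \<theta> ^ (q ^ Suc n) * (\<Sum>i\<le>n. x ^ (q ^ i) / (DC i * ell (Suc n - i) ^ (q ^ i))) + psi n x"
    by (simp add: t psi_def sum.distrib sum_distrib_left del: power_Suc)
  finally show ?thesis
    by (simp add: psi_def power_mult_distrib algebra_simps del: power_Suc)
qed

text \<open>
  This is \<open>exp\<^sub>C(log\<^sub>C(Z)) = Z\<close>. At \<open>x = 1\<close> the two recursions give
  \<open>(\<theta>^(q^n) - \<theta>) \<psi>\<^sub>n = \<psi>\<^sub>n\<^sub>-\<^sub>1^q - \<psi>\<^sub>n\<^sub>-\<^sub>1\<close>, and the right-hand side vanishes as soon as \<open>\<psi>\<^sub>n\<^sub>-\<^sub>1\<close> is \<open>0\<close> or \<open>1\<close>.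
\<close>
lemma psi_one: "psi (Suc n) 1 = 0"
proof (induction n)
  case 0
  have "(\<theta> ^ (q ^ Suc 0) - \<theta>) * psi (Suc 0) 1 = 0"
    using psi_theta_mult[of 0 1] psi_theta_mult'[of 0 1] by (simp add: algebra_simps) metis
  then show ?case
    by (metis mult_eq_0_iff right_minus_eq theta_q_power_neq zero_less_Suc)
next
  case (Suc n)
  have "(\<theta> ^ (q ^ Suc (Suc n)) - \<theta>) * psi (Suc (Suc n)) 1 = 0"
    using psi_theta_mult[of "Suc n" 1] psi_theta_mult'[of "Suc n" 1] Suc
    by (simp add: algebra_simps zero_power) metis
  then show ?case
    using theta_q_power_neq[of "Suc (Suc n)"] by (simp del: power_Suc)
qed

lemma psi_const: "psi (Suc n) (const_C c) = 0"
  using psi_const_mult[of "Suc n" c 1] by (simp add: psi_one)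

text \<open>
  So \<open>\<psi>\<^sub>n\<close> vanishes at the \<open>q^n\<close> polynomials of degree less than \<open>n\<close>, and equals \<open>1\<close> at the \<open>q^n\<close>
  monic polynomials of degree \<open>n\<close>. As a polynomial of degree \<open>q^n\<close> it is determined by its leading
  coefficient and either fact.
\<close>
lemma psi_oA: "Polynomial.degree a \<le> n \<Longrightarrow> psi n (oA a) = const_C (Polynomial.coeff a n)"
proof (induction a arbitrary: n)
  case 0
  then show ?case using psi_const_mult[of n 0 0] by simp
next
  case (pCons c a)
  show ?case
  proof (cases n)
    case 0
    with pCons have "a = 0" by (auto split: if_splits)
    then show ?thesis using 0 by simp
  next
    case (Suc m)
    have "Polynomial.degree a \<le> m" using pCons Suc by (auto split: if_splits)
    then have 1: "psi m (oA a) = const_C (Polynomial.coeff a m)" using pCons by blast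
    have "Polynomial.degree a \<le> Suc m" using \<open>Polynomial.degree a \<le> m\<close> by simp
    then have 2: "psi (Suc m) (oA a) = const_C (Polynomial.coeff a (Suc m))" using pCons by blast
    then have 2: "psi (Suc m) (oA a) = 0"
      using coeff_eq_0[of a "Suc m"] \<open>Polynomial.degree a \<le> m\<close> by simp
    show ?thesis
      using const_C_power_q[of "Polynomial.coeff a m" 1]
      by (simp add: Suc oA_pCons psi_add psi_theta_mult psi_const 1 2)
  qed
qed

lemma psi_oA_in_range: "psi n (oA a) \<in> range oA"
proof (induction a arbitrary: n)
  case 0
  then show ?case using psi_const_mult[of n 0 0] by (metis const_C_0 mult_zero_left oA_0 rangeI)
next
  case (pCons c a)
  show ?case
  proof (cases n)
    case 0
    then show ?thesis by simp
  next
    case (Suc m)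
    obtain b1 b2 where "psi (Suc m) (oA a) = oA b1" "psi m (oA a) = oA b2"
      using pCons.IH by blast
    then have "psi n (oA (pCons c a)) = \<theta> * oA b1 + oA b2 ^ q"
      by (simp only: Suc oA_pCons psi_add psi_theta_mult psi_const add_0_left)
    also have "\<dots> = oA ([:0, 1:] * b1 + b2 ^ q)"
      by (simp only: oA_add oA_mult oA_power oA_X)
    finally show ?thesis by blast
  qed
qed

text \<open>
  The condition on coefficients says \<open>deg a < n\<close> under the convention that \<open>0\<close> has degree \<open>-\<infinity>\<close>, so
  that there are exactly \<open>q^n\<close> such polynomials also for \<open>n = 0\<close>.
\<close>
definition low_degree :: "nat \<Rightarrow> 'q poly set" where
  "low_degree n = {a. \<forall>i\<ge>n. Polynomial.coeff a i = 0}"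

lemma low_degree_0: "low_degree 0 = {0}"
  by (auto simp: low_degree_def poly_eq_iff)

lemma low_degree_Suc: "low_degree (Suc n) = (\<lambda>(c, a). pCons c a) ` (UNIV \<times> low_degree n)"
proof (intro Set.set_eqI iffI)
  fix a :: "'q poly" assume a: "a \<in> low_degree (Suc n)"
  obtain c b where "a = pCons c b" by (cases a)
  moreover from this a have "b \<in> low_degree n"
    by (force simp: low_degree_def coeff_pCons split: nat.splits)
  ultimately show "a \<in> (\<lambda>(c, a). pCons c a) ` (UNIV \<times> low_degree n)" by auto
qed (auto simp: low_degree_def coeff_pCons split: nat.splits)

lemma card_low_degree: "finite (low_degree n) \<and> card (low_degree n) = q ^ n"
proof (induction n)
  case (Suc n)
  have "card (low_degree (Suc n)) = card (UNIV \<times> low_degree n :: ('q \<times> 'q poly) set)"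
    unfolding low_degree_Suc by (rule card_image) (auto simp: inj_on_def)
  with Suc show ?case by (simp add: low_degree_Suc card_cartesian_product)
qed (simp add: low_degree_0)

lemma finite_low_degree [simp]: "finite (low_degree n)"
  using card_low_degree by blast

lemma low_degree_degree: "a \<in> low_degree n \<longleftrightarrow> a = 0 \<or> Polynomial.degree a < n"
proof
  assume "a \<in> low_degree n"
  then show "a = 0 \<or> Polynomial.degree a < n"
    by (metis (mono_tags, lifting) leading_coeff_0_iff linorder_not_le low_degree_def mem_Collect_eq)
next
  show "a = 0 \<or> Polynomial.degree a < n \<Longrightarrow> a \<in> low_degree n"
    by (auto simp: low_degree_def intro: coeff_eq_0)
qed

lemma monic_of_degree_eq:
  "monic_of_degree n = (\<lambda>a. Polynomial.monom 1 n + a) ` low_degree n"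
proof (intro Set.set_eqI iffI)
  fix a :: "'q poly" assume a: "a \<in> monic_of_degree n"
  then have "a - Polynomial.monom 1 n \<in> low_degree n"
    by (auto simp: monic_of_degree_def low_degree_def coeff_eq_0)
  then show "a \<in> (\<lambda>a. Polynomial.monom 1 n + a) ` low_degree n"
    by (rule rev_image_eqI) simp
next
  fix a :: "'q poly" assume "a \<in> (\<lambda>a. Polynomial.monom 1 n + a) ` low_degree n"
  then obtain b where b: "a = Polynomial.monom 1 n + b" "b \<in> low_degree n" by auto
  then have "Polynomial.coeff a n = 1" and le: "Polynomial.degree a \<le> n"
    by (auto simp: low_degree_def intro!: degree_le)
  moreover from this have "Polynomial.degree a = n"
    using le_degree[of a n] by simp
  ultimately show "a \<in> monic_of_degree n" by (simp add: monic_of_degree_def)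
qed

lemma card_monic_of_degree: "card (monic_of_degree n :: 'q poly set) = q ^ n"
  unfolding monic_of_degree_eq using card_low_degree[of n] by (subst card_image) (auto simp: inj_on_def)

lemma finite_monic_of_degree [simp]: "finite (monic_of_degree n :: 'q poly set)"
  by (simp add: monic_of_degree_eq)

lemma monic_of_degree_nonzero: "a \<in> monic_of_degree n \<Longrightarrow> a \<noteq> 0"
  by (auto simp: monic_of_degree_def)

definition psi_poly :: "nat \<Rightarrow> 'c poly" where
  "psi_poly n = (\<Sum>i\<le>n. Polynomial.monom (1 / (DC i * ell (n - i) ^ (q ^ i))) (q ^ i))"

lemma poly_psi_poly: "poly (psi_poly n) x = psi n x"
  by (simp add: psi_poly_def psi_def poly_sum poly_monom)

lemma q_power_eq_iff: "q ^ i = q ^ j \<longleftrightarrow> i = j"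
  using q_ge_2 by (intro power_inject_exp) simp

lemma degree_psi_poly: "Polynomial.degree (psi_poly n) \<le> q ^ n"
  unfolding psi_poly_def using q_pos
  by (intro Polynomial.degree_sum_le)
     (auto intro!: order_trans[OF degree_monom_le] power_increasing simp: Suc_leI)

lemma coeff_psi_poly:
  "i \<le> n \<Longrightarrow> Polynomial.coeff (psi_poly n) (q ^ i) = 1 / (DC i * ell (n - i) ^ (q ^ i))"
  by (simp add: psi_poly_def coeff_sum coeff_monom q_power_eq_iff)

lemma monic_roots_poly:
  fixes S :: "'c set" and p :: "'c poly"
  assumes "finite S" "Polynomial.degree p \<le> card S" "\<And>x. x \<in> S \<Longrightarrow> poly p x = 0"
  shows "p = Polynomial.smult (Polynomial.coeff p (card S)) (\<Prod>x\<in>S. [:- x, 1:])"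
proof (rule poly_eqI_degree_lead_coeff[where A = S and n = "card S"])
  have d: "Polynomial.degree (\<Prod>x\<in>S. [:- x, 1:]) = card S"
    by (subst degree_prod_eq_sum_degree) auto
  have "Polynomial.lead_coeff (\<Prod>x\<in>S. [:- x, 1:]) = 1"
    by (simp add: lead_coeff_prod)
  then show "Polynomial.coeff p (card S) =
      Polynomial.coeff (Polynomial.smult (Polynomial.coeff p (card S)) (\<Prod>x\<in>S. [:- x, 1:])) (card S)"
    using d by simp
  show "Polynomial.degree (Polynomial.smult (Polynomial.coeff p (card S)) (\<Prod>x\<in>S. [:- x, 1:])) \<le> card S"
    using degree_smult_le d by metis
  show "poly p z = poly (Polynomial.smult (Polynomial.coeff p (card S)) (\<Prod>x\<in>S. [:- x, 1:])) z"
    if "z \<in> S" for z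
    using that assms by (auto simp: poly_prod prod_zero_iff)
qed (use assms in auto)

lemma psi_factorization: "psi n x = (\<Prod>a\<in>low_degree n. x - oA a) / DC n"
proof -
  have card: "card (oA ` low_degree n) = q ^ n"
    using card_low_degree[of n] by (simp add: card_image inj_on_oA)
  have "poly (psi_poly n) x = 0" if x: "x \<in> oA ` low_degree n" for x
  proof -
    obtain a where a: "a \<in> low_degree n" "x = oA a" using x by auto
    then have "Polynomial.degree a \<le> n" "Polynomial.coeff a n = 0"
      by (auto simp: low_degree_def intro: degree_le)
    then show ?thesis using a by (simp add: poly_psi_poly psi_oA)
  qed
  then have "psi_poly n = Polynomial.smult (1 / DC n) (\<Prod>x\<in>oA ` low_degree n. [:- x, 1:])"
    using monic_roots_poly[of "oA ` low_degree n" "psi_poly n"] degree_psi_poly[of n]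
      coeff_psi_poly[of n n] unfolding card by simp
  then have "poly (psi_poly n) x = (\<Prod>a\<in>low_degree n. x - oA a) / DC n"
    by (simp add: poly_prod prod.reindex[OF inj_on_oA])
  then show ?thesis by (simp add: poly_psi_poly)
qed

text \<open>
  The factorization of \<open>\<psi>\<^sub>n\<close> evaluated at \<open>\<theta>^n\<close>, where \<open>\<psi>\<^sub>n\<close> is \<open>1\<close>.
\<close>
lemma carlitz_D_eq_prod: "carlitz_D n = (\<Prod>a\<in>low_degree n. Polynomial.monom 1 n - a :: 'q poly)"
proof -
  have "psi n (oA (Polynomial.monom 1 n)) = 1"
    by (simp add: psi_oA degree_monom_le \<iota>_one)
  then have "DC n = oA (\<Prod>a\<in>low_degree n. Polynomial.monom 1 n - a)"
    by (simp add: psi_factorization oA_prod oA_diff field_simps)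
  then show ?thesis by (simp only: oA_eq_iff)
qed

text \<open>
  Compare the coefficients of \<open>x\<close> and the constant terms in \<open>\<psi>\<^sub>n(x) - 1 = \<Prod>(x - a) / D\<^sub>n\<close>, the
  product being over the monic \<open>a\<close> of degree \<open>n\<close>: the quotient of the two is \<open>-\<Sum> 1/a\<close>.
\<close>
lemma sum_inverse_monic: "(\<Sum>a\<in>monic_of_degree n. inverse (oA a)) = inverse (ell n)"
proof -
  let ?M = "monic_of_degree n :: 'q poly set"
  have card: "card (oA ` ?M) = q ^ n"
    by (simp add: card_image inj_on_oA card_monic_of_degree)
  have c1: "Polynomial.coeff (psi_poly n - 1) (q ^ n) = 1 / DC n"
    using coeff_psi_poly[of n n] by simp
  have d1: "Polynomial.degree (psi_poly n - 1) \<le> q ^ n"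
    using degree_psi_poly[of n] by (intro Polynomial.degree_diff_le) auto
  have "poly (psi_poly n - 1) x = 0" if x: "x \<in> oA ` ?M" for x
    using x by (auto simp: poly_psi_poly psi_oA monic_of_degree_def \<iota>_one)
  then have "psi_poly n - 1 = Polynomial.smult (1 / DC n) (\<Prod>x\<in>oA ` ?M. [:- x, 1:])"
    by (intro monic_roots_poly[of "oA ` ?M" "psi_poly n - 1", unfolded card c1] d1)
       (simp_all only: finite_imageI finite_monic_of_degree)
  then have fac: "psi_poly n - 1 = Polynomial.smult (1 / DC n) (\<Prod>a\<in>?M. [:- oA a, 1:])"
    by (simp add: prod.reindex[OF inj_on_oA])
  have "poly (psi_poly n - 1) 0 = - 1"
    using psi_const_mult[of n 0 0] by (simp add: poly_psi_poly)
  then have 0: "(\<Prod>a\<in>?M. - oA a) / DC n = - 1"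
    unfolding fac by (simp add: poly_prod)
  have "poly (pderiv (psi_poly n - 1)) 0 = 1 / ell n"
    using coeff_psi_poly[of 0 n] by (simp add: pderiv_diff poly_0_coeff_0 coeff_pderiv)
  moreover have "poly (pderiv (psi_poly n - 1)) 0 = (\<Sum>a\<in>?M. \<Prod>b\<in>?M - {a}. - oA b) / DC n"
    unfolding fac by (simp add: pderiv_smult pderiv_prod poly_sum poly_prod pderiv_pCons)
  moreover have "(\<Prod>b\<in>?M - {a}. - oA b) = - (\<Prod>b\<in>?M. - oA b) * inverse (oA a)" if "a \<in> ?M" for a
    using that monic_of_degree_nonzero[OF that] by (simp add: prod.remove[of ?M a] field_simps)
  ultimately have "1 / ell n = (\<Sum>a\<in>?M. - (\<Prod>b\<in>?M. - oA b) * inverse (oA a)) / DC n"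
    by simp
  also have "\<dots> = - ((\<Prod>b\<in>?M. - oA b) / DC n) * (\<Sum>a\<in>?M. inverse (oA a))"
    by (simp add: sum_negf flip: sum_distrib_left)
  finally show ?thesis
    unfolding 0 by (simp add: inverse_eq_divide)
qed

end

section \<open>Multivariate polynomials\<close>

lemma mconst_0 [simp]: "mconst 0 = 0"
  and mconst_1 [simp]: "mconst 1 = 1"
  by (simp_all add: mconst_def)

lemma mconst_add: "mconst (a + b) = mconst a + mconst b"
  and mconst_mult: "mconst (a * b) = mconst a * mconst b"
  and mconst_diff: "mconst (a - b) = mconst a - mconst b"
  by (simp_all add: mconst_def single_add mult_single single_diff)

lemma mconst_power: "mconst (a ^ n) = mconst a ^ n"
  by (induction n) (simp_all add: mconst_mult)

lemma lookup_mconst_mult: "Poly_Mapping.lookup (mconst c * F) m = c * Poly_Mapping.lookup F m"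
  by (simp add: mconst_def Poly_Mapping.map.rep_eq when_def flip: mult_map_scale_conv_mult)

lemma single_eq_mconst_mult: "Poly_Mapping.single m c = mconst c * Poly_Mapping.single m 1"
  by (simp add: mconst_def mult_single)

lemma mpoly_eq_sum_single: "F = (\<Sum>m\<in>Poly_Mapping.keys F. Poly_Mapping.single m (Poly_Mapping.lookup F m))"
  by (rule poly_mapping_eqI)
     (auto simp: lookup_sum lookup_single when_def in_keys_iff sum.delta cong: if_cong)

lemma mpoly_induct [case_names single add]:
  assumes "\<And>m c. P (Poly_Mapping.single m c)" "\<And>F G. P F \<Longrightarrow> P G \<Longrightarrow> P (F + G)"
  shows "P (F :: 'c::comm_ring_1 mpoly)"
proof -
  have "P (\<Sum>m\<in>S. Poly_Mapping.single m (f m))" for S :: "(nat \<Rightarrow>\<^sub>0 nat) set" and f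
    using assms assms(1)[of 0 0]
    by (induction S rule: infinite_finite_induct) auto
  then show ?thesis by (subst mpoly_eq_sum_single)
qed

definition scale_monom :: "nat \<Rightarrow> (nat \<Rightarrow>\<^sub>0 nat) \<Rightarrow> nat \<Rightarrow>\<^sub>0 nat" where
  "scale_monom n m = Poly_Mapping.map ((*) n) m"

lemma lookup_scale_monom [simp]: "Poly_Mapping.lookup (scale_monom n m) i = n * Poly_Mapping.lookup m i"
  by (simp add: scale_monom_def Poly_Mapping.map.rep_eq when_def)

lemma scale_monom_eq_iff: "n > 0 \<Longrightarrow> scale_monom n m = scale_monom n m' \<longleftrightarrow> m = m'"
  by (auto simp: poly_mapping_eq_iff fun_eq_iff)

lemma scale_monom_0: "scale_monom 0 m = 0"
  and scale_monom_Suc: "scale_monom (Suc n) m = m + scale_monom n m"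
  and scale_monom_scale_monom: "scale_monom n (scale_monom k m) = scale_monom (n * k) m"
  by (rule poly_mapping_eqI; simp add: lookup_add)+

lemma single_power:
  "Poly_Mapping.single m (c :: 'c::comm_ring_1) ^ n = Poly_Mapping.single (scale_monom n m) (c ^ n)"
  by (induction n) (simp_all add: scale_monom_0 scale_monom_Suc mult_single)

lemma mvar_power: "mvar i ^ n = Poly_Mapping.single (Poly_Mapping.single i n) (1 :: 'c::comm_ring_1)"
proof -
  have "scale_monom n (Poly_Mapping.single i 1) = Poly_Mapping.single i n"
    by (rule poly_mapping_eqI) (simp add: lookup_single when_def)
  then show ?thesis by (simp add: mvar_def single_power)
qed

lemma q_power_eq_sum:
  fixes F :: "'c::comm_ring_1 mpoly"
  assumes "q_power_additive TYPE('c) q"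
  shows "F ^ (q ^ i) = (\<Sum>m\<in>Poly_Mapping.keys F.
     Poly_Mapping.single (scale_monom (q ^ i) m) (Poly_Mapping.lookup F m ^ (q ^ i)))"
  by (subst mpoly_eq_sum_single)
     (simp add: q_power_sum[OF q_power_additive_mpoly[OF assms]] single_power)

text \<open>
  In characteristic \<open>p\<close> no cross terms appear, so the monomials of \<open>F^(q^i)\<close> are the \<open>q^i\<close>-fold
  multiples of those of \<open>F\<close>.
\<close>
lemma lookup_q_power:
  fixes F :: "'c::comm_ring_1 mpoly"
  assumes "q_power_additive TYPE('c) q"
  shows "Poly_Mapping.lookup (F ^ (q ^ i)) (scale_monom (q ^ i) m) = Poly_Mapping.lookup F m ^ (q ^ i)"
proof -
  have "q ^ i > 0" using assms by (simp add: q_power_additive_def)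
  then have "Poly_Mapping.lookup (F ^ (q ^ i)) (scale_monom (q ^ i) m) =
      (\<Sum>k\<in>Poly_Mapping.keys F. if k = m then Poly_Mapping.lookup F k ^ (q ^ i) else 0)"
    by (subst q_power_eq_sum[OF assms])
       (simp add: lookup_sum lookup_single when_def scale_monom_eq_iff)
  also have "\<dots> = Poly_Mapping.lookup F m ^ (q ^ i)"
    using \<open>q ^ i > 0\<close> by (auto simp: in_keys_iff zero_power)
  finally show ?thesis .
qed

subsection \<open>Substitution\<close>

definition monom_subst :: "(nat \<Rightarrow> 'c::comm_ring_1 mpoly) \<Rightarrow> (nat \<Rightarrow>\<^sub>0 nat) \<Rightarrow> 'c mpoly" where
  "monom_subst g m = (\<Prod>i\<in>Poly_Mapping.keys m. g i ^ Poly_Mapping.lookup m i)"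

lemma monom_subst_superset:
  "finite I \<Longrightarrow> Poly_Mapping.keys m \<subseteq> I \<Longrightarrow> monom_subst g m = (\<Prod>i\<in>I. g i ^ Poly_Mapping.lookup m i)"
  unfolding monom_subst_def by (rule prod.mono_neutral_left) (auto simp: in_keys_iff)

lemma monom_subst_add: "monom_subst g (m + m') = monom_subst g m * monom_subst g m'"
proof -
  let ?I = "Poly_Mapping.keys m \<union> Poly_Mapping.keys m'"
  show ?thesis
    using Poly_Mapping.keys_add[of m m']
    by (simp add: monom_subst_superset[of ?I] lookup_add power_add prod.distrib)
qed

lemma monom_subst_mvar: "monom_subst mvar m = Poly_Mapping.single m (1 :: 'c::comm_ring_1)"
proof -
  have "(\<Prod>i\<in>I. mvar i ^ f i) = Poly_Mapping.single (\<Sum>i\<in>I. Poly_Mapping.single i (f i)) (1 :: 'c)"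
    if "finite I" for I f
    using that by (induction I) (simp_all add: mvar_power mult_single)
  moreover have "(\<Sum>i\<in>Poly_Mapping.keys m. Poly_Mapping.single i (Poly_Mapping.lookup m i)) = m"
    by (rule poly_mapping_eqI)
       (auto simp: lookup_sum lookup_single when_def in_keys_iff sum.delta cong: if_cong)
  ultimately show ?thesis by (simp add: monom_subst_def)
qed

lemma msubst_superset:
  "finite M \<Longrightarrow> Poly_Mapping.keys F \<subseteq> M \<Longrightarrow>
    msubst g F = (\<Sum>m\<in>M. mconst (Poly_Mapping.lookup F m) * monom_subst g m)"
  unfolding msubst_def monom_subst_def[symmetric]
  by (rule sum.mono_neutral_left) (auto simp: in_keys_iff)

lemma msubst_single: "msubst g (Poly_Mapping.single m c) = mconst c * monom_subst g m"
  by (subst msubst_superset[of "{m}"]) (auto split: if_splits)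

lemma msubst_add: "msubst g (F + G) = msubst g F + msubst g G"
proof -
  let ?M = "Poly_Mapping.keys F \<union> Poly_Mapping.keys G"
  show ?thesis
    using Poly_Mapping.keys_add[of F G]
    by (simp add: msubst_superset[of ?M] lookup_add mconst_add distrib_right sum.distrib)
qed

lemma msubst_0 [simp]: "msubst g 0 = 0"
  by (simp add: msubst_def)

lemma msubst_sum: "msubst g (\<Sum>i\<in>I. f i) = (\<Sum>i\<in>I. msubst g (f i))"
  by (induction I rule: infinite_finite_induct) (simp_all add: msubst_add)

lemma msubst_mult: "msubst g (F * G) = msubst g F * msubst g G"
proof (induction F rule: mpoly_induct)
  case (single m c)
  show ?case
    by (induction G rule: mpoly_induct)
       (simp_all add: mult_single msubst_single monom_subst_add mconst_mult msubst_add algebra_simps)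
qed (simp add: msubst_add algebra_simps)

lemma msubst_mconst [simp]: "msubst g (mconst c) = mconst c"
  by (simp add: mconst_def msubst_single[of g 0] monom_subst_def)

lemma msubst_1 [simp]: "msubst g 1 = 1"
  using msubst_mconst[of g 1] by simp

lemma msubst_power: "msubst g (F ^ n) = msubst g F ^ n"
  by (induction n) (simp_all add: msubst_mult)

lemma msubst_prod: "msubst g (\<Prod>i\<in>I. f i) = (\<Prod>i\<in>I. msubst g (f i))"
  by (induction I rule: infinite_finite_induct) (simp_all add: msubst_mult)

lemma msubst_mvar [simp]: "msubst g (mvar i) = g i"
  by (simp add: mvar_def msubst_single monom_subst_def)

lemma msubst_msubst: "msubst g (msubst h F) = msubst (\<lambda>i. msubst g (h i)) F"
  by (simp add: msubst_def[of h] msubst_def[of "\<lambda>i. msubst g (h i)"]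
        msubst_sum msubst_mult msubst_prod msubst_power)

subsection \<open>Polynomials with coefficients in a subring\<close>

definition is_subring :: "'a::comm_ring_1 set \<Rightarrow> bool" where
  "is_subring R \<longleftrightarrow> 1 \<in> R \<and> (\<forall>x\<in>R. \<forall>y\<in>R. x - y \<in> R \<and> x * y \<in> R)"

lemma is_subring_closed:
  assumes "is_subring R"
  shows "0 \<in> R" "1 \<in> R" "x \<in> R \<Longrightarrow> y \<in> R \<Longrightarrow> x - y \<in> R" "x \<in> R \<Longrightarrow> y \<in> R \<Longrightarrow> x * y \<in> R"
    "x \<in> R \<Longrightarrow> - x \<in> R" "x \<in> R \<Longrightarrow> y \<in> R \<Longrightarrow> x + y \<in> R" "x \<in> R \<Longrightarrow> x ^ n \<in> R"
proof -
  show 1: "1 \<in> R" and d: "\<And>x y. x \<in> R \<Longrightarrow> y \<in> R \<Longrightarrow> x - y \<in> R"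
    and m: "\<And>x y. x \<in> R \<Longrightarrow> y \<in> R \<Longrightarrow> x * y \<in> R"
    using assms by (auto simp: is_subring_def)
  show 0: "0 \<in> R" using d[OF 1 1] by simp
  show u: "- x \<in> R" if "x \<in> R" for x using d[OF 0 that] by simp
  show "x \<in> R \<Longrightarrow> y \<in> R \<Longrightarrow> x + y \<in> R" using d[of x "- y"] u[of y] by simp
  show "x ^ n \<in> R" if "x \<in> R" using 1 m[OF that] by (induction n) auto
qed

lemma is_subring_UNIV: "is_subring UNIV"
  by (simp add: is_subring_def)

lemma mpolys_lookup: "F \<in> mpolys R s \<Longrightarrow> Poly_Mapping.lookup F m \<in> R"
  by (simp add: mpolys_def)

lemma mpolys_keys: "F \<in> mpolys R s \<Longrightarrow> m \<in> Poly_Mapping.keys F \<Longrightarrow> Poly_Mapping.keys m \<subseteq> {1..s}"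
  by (simp add: mpolys_def)

lemma mpolys_mono: "R \<subseteq> R' \<Longrightarrow> mpolys R s \<subseteq> mpolys R' s"
  by (auto simp: mpolys_def)

lemma mpolys_single:
  "0 \<in> R \<Longrightarrow> c \<in> R \<Longrightarrow> Poly_Mapping.keys m \<subseteq> {1..s} \<Longrightarrow> Poly_Mapping.single m c \<in> mpolys R s"
  by (auto simp: mpolys_def lookup_single when_def split: if_splits)

context
  fixes R :: "'c::comm_ring_1 set" and s :: nat
  assumes R: "is_subring R"
begin

lemma mpolys_mconst: "c \<in> R \<Longrightarrow> mconst c \<in> mpolys R s"
  unfolding mconst_def by (rule mpolys_single) (auto simp: is_subring_closed[OF R])

lemma mpolys_0: "0 \<in> mpolys R s"
  and mpolys_1: "1 \<in> mpolys R s"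
  using mpolys_mconst[of 0] mpolys_mconst[of 1] by (auto simp: is_subring_closed[OF R])

lemma mpolys_mvar: "i \<in> {1..s} \<Longrightarrow> mvar i \<in> mpolys R s"
  unfolding mvar_def by (rule mpolys_single) (auto simp: is_subring_closed[OF R])

lemma mpolys_add: "F \<in> mpolys R s \<Longrightarrow> G \<in> mpolys R s \<Longrightarrow> F + G \<in> mpolys R s"
  using Poly_Mapping.keys_add[of F G]
  by (fastforce simp: mpolys_def lookup_add is_subring_closed[OF R])

lemma mpolys_sum: "(\<And>i. i \<in> I \<Longrightarrow> f i \<in> mpolys R s) \<Longrightarrow> (\<Sum>i\<in>I. f i) \<in> mpolys R s"
  by (induction I rule: infinite_finite_induct) (auto intro: mpolys_add mpolys_0)

lemma mpolys_mult:
  assumes "F \<in> mpolys R s" "G \<in> mpolys R s"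
  shows "F * G \<in> mpolys R s"
proof -
  let ?s = "\<lambda>F m. Poly_Mapping.single m (Poly_Mapping.lookup F m)"
  have "F * G = (\<Sum>m\<in>Poly_Mapping.keys F. ?s F m) * (\<Sum>m\<in>Poly_Mapping.keys G. ?s G m)"
    by (simp only: mpoly_eq_sum_single[symmetric])
  also have "\<dots> = (\<Sum>m\<in>Poly_Mapping.keys F. \<Sum>m'\<in>Poly_Mapping.keys G.
      Poly_Mapping.single (m + m') (Poly_Mapping.lookup F m * Poly_Mapping.lookup G m'))"
    by (simp add: sum_product mult_single)
  also have "\<dots> \<in> mpolys R s"
  proof (intro mpolys_sum mpolys_single)
    show "Poly_Mapping.keys (m + m') \<subseteq> {1..s}"
      if "m \<in> Poly_Mapping.keys F" "m' \<in> Poly_Mapping.keys G" for m m'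
      using Poly_Mapping.keys_add[of m m'] mpolys_keys[OF assms(1) that(1)]
        mpolys_keys[OF assms(2) that(2)] by blast
  qed (use assms in \<open>auto simp: is_subring_closed[OF R] mpolys_lookup\<close>)
  finally show ?thesis .
qed

lemma mpolys_mconst_mult: "c \<in> R \<Longrightarrow> F \<in> mpolys R s \<Longrightarrow> mconst c * F \<in> mpolys R s"
  by (intro mpolys_mult mpolys_mconst)

lemma mpolys_minus: "F \<in> mpolys R s \<Longrightarrow> - F \<in> mpolys R s"
  by (auto simp: mpolys_def is_subring_closed[OF R])

lemma mpolys_diff: "F \<in> mpolys R s \<Longrightarrow> G \<in> mpolys R s \<Longrightarrow> F - G \<in> mpolys R s"
  using mpolys_add[of F "- G"] mpolys_minus[of G] by simp

lemma mpolys_power: "F \<in> mpolys R s \<Longrightarrow> F ^ n \<in> mpolys R s"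
  by (induction n) (auto intro: mpolys_mult mpolys_1)

lemma mpolys_prod: "(\<And>i. i \<in> I \<Longrightarrow> f i \<in> mpolys R s) \<Longrightarrow> (\<Prod>i\<in>I. f i) \<in> mpolys R s"
  by (induction I rule: infinite_finite_induct) (auto intro: mpolys_mult mpolys_1)

lemma mpolys_monom_subst:
  "Poly_Mapping.keys m \<subseteq> {1..s} \<Longrightarrow> (\<And>i. i \<in> {1..s} \<Longrightarrow> g i \<in> mpolys R s) \<Longrightarrow> monom_subst g m \<in> mpolys R s"
  unfolding monom_subst_def by (intro mpolys_prod mpolys_power) auto

lemma mpolys_msubst:
  assumes "F \<in> mpolys R s" "\<And>i. i \<in> {1..s} \<Longrightarrow> g i \<in> mpolys R s"
  shows "msubst g F \<in> mpolys R s"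
  unfolding msubst_def monom_subst_def[symmetric]
  using assms by (intro mpolys_sum mpolys_mult mpolys_mconst mpolys_monom_subst)
    (blast dest: mpolys_lookup mpolys_keys)+

end

subsection \<open>Leading monomials with respect to the total degree\<close>

definition total_degree :: "(nat \<Rightarrow>\<^sub>0 nat) \<Rightarrow> nat" where
  "total_degree m = (\<Sum>i\<in>Poly_Mapping.keys m. Poly_Mapping.lookup m i)"

lemma total_degree_superset:
  "finite I \<Longrightarrow> Poly_Mapping.keys m \<subseteq> I \<Longrightarrow> total_degree m = (\<Sum>i\<in>I. Poly_Mapping.lookup m i)"
  unfolding total_degree_def by (rule sum.mono_neutral_left) (auto simp: in_keys_iff)

lemma total_degree_add: "total_degree (m + m') = total_degree m + total_degree m'"
proof -
  let ?I = "Poly_Mapping.keys m \<union> Poly_Mapping.keys m'"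
  show ?thesis
    using Poly_Mapping.keys_add[of m m']
    by (simp add: total_degree_superset[of ?I] lookup_add sum.distrib)
qed

lemma total_degree_single [simp]: "total_degree (Poly_Mapping.single i n) = n"
  by (subst total_degree_superset[of "{i}"]) auto

lemma total_degree_scale_monom: "total_degree (scale_monom n m) = n * total_degree m"
  by (subst total_degree_superset[of "Poly_Mapping.keys m"])
     (auto simp: total_degree_def sum_distrib_left in_keys_iff)

definition below_degree :: "nat \<Rightarrow> 'c::comm_ring_1 mpoly set" where
  "below_degree d = {F. \<forall>m\<in>Poly_Mapping.keys F. total_degree m < d}"

lemma below_degree_add: "F \<in> below_degree d \<Longrightarrow> G \<in> below_degree d \<Longrightarrow> F + G \<in> below_degree d"
  using Poly_Mapping.keys_add[of F G] by (fastforce simp: below_degree_def)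

lemma below_degree_0: "0 \<in> below_degree d"
  by (simp add: below_degree_def)

lemma below_degree_sum: "(\<And>i. i \<in> I \<Longrightarrow> f i \<in> below_degree d) \<Longrightarrow> (\<Sum>i\<in>I. f i) \<in> below_degree d"
  by (induction I rule: infinite_finite_induct) (auto intro: below_degree_add below_degree_0)

lemma below_degree_mono: "F \<in> below_degree d \<Longrightarrow> d \<le> d' \<Longrightarrow> F \<in> below_degree d'"
  by (fastforce simp: below_degree_def)

lemma below_degree_mult:
  assumes "F \<in> below_degree d" "G \<in> below_degree (Suc e)"
  shows "F * G \<in> below_degree (d + e)"
  unfolding below_degree_def
proof (intro CollectI ballI)
  fix m assume "m \<in> Poly_Mapping.keys (F * G)"
  then obtain a b where "m = a + b" "a \<in> Poly_Mapping.keys F" "b \<in> Poly_Mapping.keys G"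
    using Poly_Mapping.keys_mult[of F G] by auto
  then show "total_degree m < d + e"
    using assms by (fastforce simp: below_degree_def total_degree_add)
qed

text \<open>
  Asking for strictly smaller total degree is more than asking for a leading monomial in a monomial
  order. It determines the coefficients of \<open>F\<close> at all monomials of at least the degree of \<open>m\<close>, and it
  is stable under products.
\<close>
definition has_leading_monom :: "'c::comm_ring_1 mpoly \<Rightarrow> (nat \<Rightarrow>\<^sub>0 nat) \<Rightarrow> bool" where
  "has_leading_monom F m \<longleftrightarrow> F - Poly_Mapping.single m 1 \<in> below_degree (total_degree m)"

lemma single_in_below_degree: "total_degree m < d \<Longrightarrow> Poly_Mapping.single m c \<in> below_degree d"
  by (auto simp: below_degree_def split: if_splits)

lemma has_leading_monom_mult:
  assumes "has_leading_monom F m" "has_leading_monom G m'"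
  shows "has_leading_monom (F * G) (m + m')"
proof -
  let ?d = "total_degree m" and ?d' = "total_degree m'"
  let ?M = "Poly_Mapping.single m 1" and ?M' = "Poly_Mapping.single m' 1"
  have F: "F - ?M \<in> below_degree ?d" and G: "G - ?M' \<in> below_degree ?d'"
    using assms by (auto simp: has_leading_monom_def)
  have "(F - ?M) * (G - ?M') + (F - ?M) * ?M' + (G - ?M') * ?M \<in> below_degree (?d + ?d')"
    using below_degree_mult[OF F, of "G - ?M'" ?d'] below_degree_mult[OF F, of ?M' ?d']
      below_degree_mult[OF G, of ?M ?d] below_degree_mono[OF G, of "Suc ?d'"]
    by (intro below_degree_add) (auto simp: single_in_below_degree add.commute)
  also have "(F - ?M) * (G - ?M') + (F - ?M) * ?M' + (G - ?M') * ?M = F * G - ?M * ?M'"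
    by (simp add: algebra_simps)
  finally show ?thesis
    by (simp add: has_leading_monom_def mult_single total_degree_add)
qed

lemma has_leading_monom_1: "has_leading_monom 1 0"
  by (simp add: has_leading_monom_def below_degree_0)

lemma has_leading_monom_power: "has_leading_monom F m \<Longrightarrow> has_leading_monom (F ^ n) (scale_monom n m)"
  by (induction n)
     (auto simp: scale_monom_0 scale_monom_Suc has_leading_monom_1 intro: has_leading_monom_mult)

lemma has_leading_monom_prod:
  "finite I \<Longrightarrow> (\<And>i. i \<in> I \<Longrightarrow> has_leading_monom (F i) (m i)) \<Longrightarrow>
    has_leading_monom (\<Prod>i\<in>I. F i) (\<Sum>i\<in>I. m i)"
  by (induction I rule: finite_induct) (auto simp: has_leading_monom_1 intro: has_leading_monom_mult)

lemma has_leading_monom_monom_subst: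
  assumes "\<And>i. has_leading_monom (g i) (Poly_Mapping.single i n)"
  shows "has_leading_monom (monom_subst g m) (scale_monom n m)"
proof -
  have "(\<Sum>i\<in>Poly_Mapping.keys m. scale_monom (Poly_Mapping.lookup m i) (Poly_Mapping.single i n)) = scale_monom n m"
    by (rule poly_mapping_eqI)
       (auto simp: lookup_sum lookup_single when_def in_keys_iff sum.delta if_distrib cong: if_cong)
  then show ?thesis
    unfolding monom_subst_def
    using has_leading_monom_prod[of "Poly_Mapping.keys m" "\<lambda>i. g i ^ Poly_Mapping.lookup m i"
        "\<lambda>i. scale_monom (Poly_Mapping.lookup m i) (Poly_Mapping.single i n)"]
      has_leading_monom_power[OF assms] by simp
qed

lemma lookup_has_leading_monom:
  assumes "has_leading_monom F m" "total_degree m \<le> total_degree k"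
  shows "Poly_Mapping.lookup F k = (if k = m then 1 else 0)"
proof -
  have "k \<notin> Poly_Mapping.keys (F - Poly_Mapping.single m 1)"
    using assms by (auto simp: has_leading_monom_def below_degree_def)
  then show ?thesis
    by (auto simp: in_keys_iff lookup_minus lookup_single when_def split: if_splits)
qed

section \<open>The Carlitz module on multivariate polynomials\<close>

lemma poly_map_poly_pcompose:
  fixes h :: "'a::comm_ring_1 \<Rightarrow> 'b::comm_ring_1"
  assumes 0: "h 0 = 0" and add: "\<And>x y. h (x + y) = h x + h y" and mult: "\<And>x y. h (x * y) = h x * h y"
  shows "poly (map_poly h (p + r)) x = poly (map_poly h p) x + poly (map_poly h r) x"
    and "poly (map_poly h (Polynomial.smult c p)) x = h c * poly (map_poly h p) x"
    and "poly (map_poly h (p * r)) x = poly (map_poly h p) x * poly (map_poly h r) x"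
    and "poly (map_poly h (pcompose p r)) x = poly (map_poly h p) (poly (map_poly h r) x)"
proof -
  show 1: "poly (map_poly h (p + r)) x = poly (map_poly h p) x + poly (map_poly h r) x" for p r
    by (induction p r rule: poly_induct2)
       (simp_all add: map_poly_pCons[of h, OF 0] add algebra_simps)
  show 2: "poly (map_poly h (Polynomial.smult c p)) x = h c * poly (map_poly h p) x" for c p
    by (simp add: map_poly_smult[of h, OF 0 mult])
  show 3: "poly (map_poly h (p * r)) x = poly (map_poly h p) x * poly (map_poly h r) x" for p r
    by (induction p) (simp_all add: 1 2 map_poly_pCons[of h, OF 0] 0 algebra_simps)
  show "poly (map_poly h (pcompose p r)) x = poly (map_poly h p) (poly (map_poly h r) x)"
    by (induction p) (simp_all add: 1 3 pcompose_pCons map_poly_pCons[of h, OF 0] 0)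
qed

context carlitz_complex_q
begin

definition carlitz_eval :: "'q poly \<Rightarrow> 'c mpoly \<Rightarrow> 'c mpoly" where
  "carlitz_eval a x = poly (map_poly (\<lambda>b. mconst (oA b)) (carlitz a)) x"

lemma carlitz_var_eq: "carlitz_var \<iota> a i = carlitz_eval a (mvar i)"
  by (simp add: carlitz_var_def carlitz_eval_def)

lemma poly_map_oA:
  fixes p r :: "'q poly poly"
  shows "poly (map_poly (\<lambda>b. mconst (oA b)) (p + r)) x =
      poly (map_poly (\<lambda>b. mconst (oA b)) p) x + poly (map_poly (\<lambda>b. mconst (oA b)) r) x"
    and "poly (map_poly (\<lambda>b. mconst (oA b)) (Polynomial.smult c p)) x =
      mconst (oA c) * poly (map_poly (\<lambda>b. mconst (oA b)) p) x"
    and "poly (map_poly (\<lambda>b. mconst (oA b)) (p * r)) x =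
      poly (map_poly (\<lambda>b. mconst (oA b)) p) x * poly (map_poly (\<lambda>b. mconst (oA b)) r) x"
    and "poly (map_poly (\<lambda>b. mconst (oA b)) (pcompose p r)) x =
      poly (map_poly (\<lambda>b. mconst (oA b)) p) (poly (map_poly (\<lambda>b. mconst (oA b)) r) x)"
  by (rule poly_map_poly_pcompose; simp add: oA_add oA_mult mconst_add mconst_mult)+

lemma carlitz_eval_0 [simp]: "carlitz_eval 0 x = 0"
  by (simp add: carlitz_eval_def)

lemma carlitz_eval_mult: "carlitz_eval (a * b) x = carlitz_eval a (carlitz_eval b x)"
  by (simp add: carlitz_eval_def carlitz_mult poly_map_oA)

lemma carlitz_eval_pCons:
  "carlitz_eval (pCons c a) x =
    mconst (const_C c) * x + mconst \<theta> * carlitz_eval a x + carlitz_eval a x ^ q"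
proof -
  have p: "poly (map_poly (\<lambda>b. mconst (oA b)) (r ^ n)) x = poly (map_poly (\<lambda>b. mconst (oA b)) r) x ^ n"
    for r :: "'q poly poly" and n
    by (induction n) (simp_all add: poly_map_oA)
  have "mconst (oA [:0, 1:]) = mconst \<theta>"
    by (simp only: oA_X)
  then show ?thesis
    unfolding carlitz_eval_def carlitz_pCons pcompose_carlitz_theta card_q poly_map_oA p
    by (simp add: map_poly_pCons \<iota>_one)
qed

text \<open>
  The coefficient of \<open>X^(q^k)\<close> in \<open>C\<^sub>a(X)\<close> is \<open>\<psi>\<^sub>k(a)\<close>, since both satisfy the recursion that comes from
  \<open>C\<^sub>c\<^sub>+\<^sub>\<theta>\<^sub>a = c X + \<theta> C\<^sub>a + C\<^sub>a^q\<close>. The summation bound is left free above \<open>deg a\<close> for the induction.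
\<close>
lemma carlitz_eval_eq_sum:
  "Polynomial.degree a \<le> n \<Longrightarrow>
    carlitz_eval a x = (\<Sum>k\<le>n. mconst (psi k (oA a)) * x ^ (q ^ k))"
proof (induction a arbitrary: n)
  case 0
  then show ?case using psi_const_mult[of _ 0 0] by simp
next
  case (pCons c a)
  show ?case
  proof (cases n)
    case 0
    with pCons have "a = 0" by (auto split: if_splits)
    then show ?thesis using 0 by (simp add: carlitz_eval_pCons zero_power)
  next
    case (Suc m)
    have m: "Polynomial.degree a \<le> m" using pCons Suc by (auto split: if_splits)
    have "carlitz_eval (pCons c a) x = mconst (const_C c) * x
       + mconst \<theta> * (\<Sum>k\<le>Suc m. mconst (psi k (oA a)) * x ^ (q ^ k))
       + (\<Sum>k\<le>m. mconst (psi k (oA a)) * x ^ (q ^ k)) ^ q"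
      using m by (simp only: carlitz_eval_pCons pCons.IH[of m, symmetric]
          pCons.IH[of "Suc m", symmetric] le_SucI)
    also have "\<dots> = mconst (const_C c + \<theta> * oA a) * x +
       (\<Sum>k\<le>m. mconst (psi (Suc k) (const_C c + \<theta> * oA a)) * x ^ (q ^ Suc k))"
      by (subst sum.atMost_Suc_shift)
         (simp add: q_power_MP1 psi_add psi_theta_mult psi_const mconst_add mconst_mult mconst_power
           power_mult_distrib algebra_simps sum.distrib sum_distrib_left flip: power_mult)
    also have "\<dots> = (\<Sum>k\<le>Suc m. mconst (psi k (oA (pCons c a))) * x ^ (q ^ k))"
      by (subst sum.atMost_Suc_shift) (simp add: oA_pCons)
    finally show ?thesis by (simp add: Suc)
  qed
qed

lemma msubst_carlitz_eval: "msubst g (carlitz_eval a x) = carlitz_eval a (msubst g x)"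
  by (simp add: carlitz_eval_eq_sum[OF order_refl] msubst_sum msubst_mult msubst_power)

text \<open>
  The coefficient of \<open>Z^(q^n)\<close> in \<open>exp\<^sub>C(\<Sum>\<^sub>d S\<^sub>d Z^(q^d))\<close>.
\<close>
definition exp_coeff :: "(nat \<Rightarrow> 'c mpoly) \<Rightarrow> nat \<Rightarrow> 'c mpoly" where
  "exp_coeff S n = (\<Sum>i\<le>n. mconst (inverse (DC i)) * S (n - i) ^ (q ^ i))"

lemma exp_coeff_add: "exp_coeff (\<lambda>d. S d + T d) n = exp_coeff S n + exp_coeff T n"
  by (simp add: exp_coeff_def q_power_MP distrib_left sum.distrib)

lemma exp_coeff_const_mult:
  "exp_coeff (\<lambda>d. mconst (const_C c) * S d) n = mconst (const_C c) * exp_coeff S n"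
  by (simp add: exp_coeff_def power_mult_distrib sum_distrib_left algebra_simps const_C_power_q
      flip: mconst_power)

lemma exp_coeff_theta_mult:
  "exp_coeff (\<lambda>d. mconst \<theta> * S d) (Suc n) = mconst \<theta> * exp_coeff S (Suc n) + exp_coeff S n ^ q"
proof -
  have D: "inverse (DC (Suc i)) * \<theta> ^ (q ^ Suc i) = \<theta> * inverse (DC (Suc i)) + inverse (DC i) ^ q" for i
  proof -
    have "DC (Suc i) \<noteq> 0" by simp
    then have "\<theta> ^ (q ^ Suc i) - \<theta> \<noteq> 0" unfolding DC_Suc by auto
    then show ?thesis unfolding DC_Suc by (simp add: field_simps del: power_Suc)
  qed
  have t: "mconst (inverse (DC (Suc i))) * (mconst \<theta> * S (n - i)) ^ (q ^ Suc i) =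
    mconst \<theta> * (mconst (inverse (DC (Suc i))) * S (n - i) ^ (q ^ Suc i))
    + (mconst (inverse (DC i)) * S (n - i) ^ (q ^ i)) ^ q" for i
  proof -
    have "mconst (inverse (DC (Suc i))) * (mconst \<theta> * S (n - i)) ^ (q ^ Suc i) =
       mconst (inverse (DC (Suc i)) * \<theta> ^ (q ^ Suc i)) * S (n - i) ^ (q ^ Suc i)"
      by (simp only: mconst_mult mconst_power power_mult_distrib mult.assoc)
    then show ?thesis
      unfolding D by (simp add: mconst_mult mconst_add mconst_power power_mult_distrib algebra_simps
          flip: power_mult)
  qed
  have s: "exp_coeff U (Suc n) = U (Suc n) +
      (\<Sum>i\<le>n. mconst (inverse (DC (Suc i))) * U (n - i) ^ (q ^ Suc i))" for U
    unfolding exp_coeff_def by (subst sum.atMost_Suc_shift) simp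
  show ?thesis
    unfolding s t sum.distrib sum_distrib_left[symmetric]
    by (simp add: exp_coeff_def q_power_MP1 algebra_simps)
qed

text \<open>
  The functional equation \<open>exp\<^sub>C(a G) = C\<^sub>a(exp\<^sub>C(G))\<close>.
\<close>
lemma exp_coeff_scalar_mult:
  "exp_coeff (\<lambda>d. mconst (oA a) * S d) n =
     (\<Sum>k\<le>n. mconst (psi k (oA a)) * exp_coeff S (n - k) ^ (q ^ k))"
proof (induction a arbitrary: n)
  case 0
  then show ?case using psi_const_mult[of _ 0 0] by (simp add: exp_coeff_def zero_power)
next
  case (pCons c a)
  have e: "exp_coeff (\<lambda>d. mconst (oA (pCons c a)) * S d) n =
     mconst (const_C c) * exp_coeff S n + exp_coeff (\<lambda>d. mconst \<theta> * (mconst (oA a) * S d)) n" for n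
    using exp_coeff_add[of "\<lambda>d. mconst (const_C c) * S d" "\<lambda>d. mconst \<theta> * (mconst (oA a) * S d)"]
    by (simp add: oA_pCons mconst_add mconst_mult distrib_right mult.assoc exp_coeff_const_mult)
  show ?case
  proof (cases n)
    case 0
    then show ?thesis by (simp add: exp_coeff_def)
  next
    case (Suc m)
    have "exp_coeff (\<lambda>d. mconst (oA (pCons c a)) * S d) (Suc m) =
       mconst (const_C c) * exp_coeff S (Suc m)
       + mconst \<theta> * (\<Sum>k\<le>Suc m. mconst (psi k (oA a)) * exp_coeff S (Suc m - k) ^ (q ^ k))
       + (\<Sum>k\<le>m. mconst (psi k (oA a)) * exp_coeff S (m - k) ^ (q ^ k)) ^ q"
      unfolding e exp_coeff_theta_mult pCons.IH by (simp add: algebra_simps)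
    also have "\<dots> = mconst (const_C c + \<theta> * oA a) * exp_coeff S (Suc m) +
       (\<Sum>k\<le>m. mconst (psi (Suc k) (const_C c + \<theta> * oA a)) * exp_coeff S (m - k) ^ (q ^ Suc k))"
      by (subst sum.atMost_Suc_shift)
         (simp add: q_power_MP1 psi_add psi_theta_mult psi_const mconst_add mconst_mult mconst_power
           power_mult_distrib algebra_simps sum.distrib sum_distrib_left flip: power_mult)
    also have "\<dots> = (\<Sum>k\<le>Suc m. mconst (psi k (oA (pCons c a))) * exp_coeff S (Suc m - k) ^ (q ^ k))"
      by (subst sum.atMost_Suc_shift) (simp add: oA_pCons)
    finally show ?thesis by (simp add: Suc)
  qed
qed

definition carlitz_sum :: "'c mpoly \<Rightarrow> nat \<Rightarrow> 'c mpoly" where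
  "carlitz_sum F d = (\<Sum>a\<in>monic_of_degree d. mconst (inverse (oA a)) * msubst (carlitz_var \<iota> a) F)"

definition L_coeff :: "'c mpoly \<Rightarrow> nat \<Rightarrow> 'c mpoly" where
  "L_coeff F = exp_coeff (carlitz_sum F)"

lemma L_coeff_add: "L_coeff (F + G) n = L_coeff F n + L_coeff G n"
proof -
  have "carlitz_sum (F + G) = (\<lambda>d. carlitz_sum F d + carlitz_sum G d)"
    by (simp add: carlitz_sum_def fun_eq_iff msubst_add distrib_left sum.distrib)
  then show ?thesis by (simp add: L_coeff_def exp_coeff_add)
qed

lemma carlitz_var_in_mpolys:
  assumes "is_subring R" "range oA \<subseteq> R" "i \<in> {1..s}"
  shows "carlitz_var \<iota> a i \<in> mpolys R s"
  unfolding carlitz_var_eq carlitz_eval_eq_sum[OF order_refl]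
  using psi_oA_in_range assms
  by (intro mpolys_sum mpolys_mult mpolys_mconst mpolys_power mpolys_mvar) auto

lemma L_coeff_UNIV:
  assumes "F \<in> mpolys UNIV s"
  shows "L_coeff F n \<in> mpolys UNIV s"
  unfolding L_coeff_def exp_coeff_def carlitz_sum_def using assms
  by (intro mpolys_sum mpolys_mult mpolys_mconst mpolys_power mpolys_msubst carlitz_var_in_mpolys
      is_subring_UNIV) auto

subsection \<open>The leading term\<close>

lemma has_leading_monom_carlitz_var:
  assumes "a \<in> monic_of_degree d"
  shows "has_leading_monom (carlitz_var \<iota> a i) (Poly_Mapping.single i (q ^ d))"
proof -
  have d: "Polynomial.degree a \<le> d" and 1: "psi d (oA a) = 1"
    using assms by (auto simp: monic_of_degree_def psi_oA \<iota>_one)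
  have "carlitz_var \<iota> a i = (\<Sum>k<d. mconst (psi k (oA a)) * mvar i ^ (q ^ k)) + mvar i ^ (q ^ d)"
    unfolding carlitz_var_eq carlitz_eval_eq_sum[OF d]
    by (simp add: 1 lessThan_Suc_atMost[symmetric])
  moreover have "(\<Sum>k<d. mconst (psi k (oA a)) * mvar i ^ (q ^ k)) \<in> below_degree (q ^ d)"
    using q_ge_2 unfolding mvar_power
    by (intro below_degree_sum)
       (auto simp: power_strict_increasing_iff intro!: single_in_below_degree
         simp flip: single_eq_mconst_mult)
  ultimately show ?thesis
    by (simp add: has_leading_monom_def mvar_power)
qed

text \<open>
  All monomials of \<open>F(C\<^sub>a(X))^(q^i)\<close> with \<open>deg a = n - i\<close> have total degree at most \<open>q^n\<close> times that of
  \<open>F\<close>, and \<open>X^(q^n m)\<close> with \<open>m\<close> of top degree can only come from the leading term of \<open>C\<^sub>a(X)^m\<close>. The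
  contributions \<open>f^(q^i) (\<Sum> 1/a)^(q^i) / D\<^sub>i\<close> add up to \<open>\<psi>\<^sub>n(f)\<close>.
\<close>
lemma lookup_L_coeff_leading:
  assumes m: "\<And>k. k \<in> Poly_Mapping.keys F \<Longrightarrow> total_degree k \<le> total_degree m"
  shows "Poly_Mapping.lookup (L_coeff F n) (scale_monom (q ^ n) m) = psi n (Poly_Mapping.lookup F m)"
proof -
  have 1: "Poly_Mapping.lookup (msubst (carlitz_var \<iota> a) F) (scale_monom (q ^ d) m) = Poly_Mapping.lookup F m"
    if "a \<in> monic_of_degree d" for a d
  proof -
    have "Poly_Mapping.lookup (monom_subst (carlitz_var \<iota> a) k) (scale_monom (q ^ d) m) = (if k = m then 1 else 0)"
      if "k \<in> Poly_Mapping.keys F" for k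
      using lookup_has_leading_monom[OF has_leading_monom_monom_subst[of "carlitz_var \<iota> a" "q ^ d" k], of "scale_monom (q ^ d) m"]
        has_leading_monom_carlitz_var[OF \<open>a \<in> monic_of_degree d\<close>] m[OF that]
      by (auto simp: total_degree_scale_monom scale_monom_eq_iff)
    then have "Poly_Mapping.lookup (msubst (carlitz_var \<iota> a) F) (scale_monom (q ^ d) m) =
        (\<Sum>k\<in>Poly_Mapping.keys F. if k = m then Poly_Mapping.lookup F k else 0)"
      unfolding msubst_def monom_subst_def[symmetric]
      by (simp add: lookup_sum lookup_mconst_mult mult_delta_right cong: sum.cong)
    then show ?thesis by (auto simp: in_keys_iff)
  qed
  have 2: "Poly_Mapping.lookup (carlitz_sum F d) (scale_monom (q ^ d) m) = Poly_Mapping.lookup F m / ell d" for d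
  proof -
    have "Poly_Mapping.lookup (carlitz_sum F d) (scale_monom (q ^ d) m) =
       (\<Sum>a\<in>monic_of_degree d. inverse (oA a)) * Poly_Mapping.lookup F m"
      by (simp add: carlitz_sum_def lookup_sum lookup_mconst_mult 1 sum_distrib_right)
    then show ?thesis by (simp add: sum_inverse_monic divide_inverse mult.commute)
  qed
  have "Poly_Mapping.lookup (carlitz_sum F (n - i) ^ (q ^ i)) (scale_monom (q ^ n) m) =
      (Poly_Mapping.lookup F m / ell (n - i)) ^ (q ^ i)" if "i \<le> n" for i
    using lookup_q_power[OF q_power_additive_C, of "carlitz_sum F (n - i)" i "scale_monom (q ^ (n - i)) m"] that
    by (simp add: scale_monom_scale_monom 2 flip: power_add)
  then show ?thesis
    by (simp add: L_coeff_def exp_coeff_def lookup_sum lookup_mconst_mult psi_def divide_inverse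
        power_mult_distrib power_inverse algebra_simps)
qed

section \<open>Integrality at a prime\<close>

context
  fixes P :: "'q poly"
  assumes irreducible: "Factorial_Ring.irreducible P" and monic: "Polynomial.lead_coeff P = 1"
begin

abbreviation "degP \<equiv> Polynomial.degree P"

lemma P_nonzero [simp]: "P \<noteq> 0"
  using monic by auto

lemma not_P_dvd_1: "\<not> P dvd 1"
  using irreducible by (simp add: Factorial_Ring.irreducible_def)

lemma degP_pos: "degP > 0"
proof (rule ccontr)
  assume "\<not> degP > 0"
  then obtain c where "P = [:c:]" by (auto elim: degree_eq_zeroE)
  then have "P = 1" using monic by (simp add: one_pCons)
  then show False using not_P_dvd_1 by simp
qed

lemma P_dvd_mult_iff: "P dvd a * b \<longleftrightarrow> P dvd a \<or> P dvd b"
  by (rule prime_elem_dvd_mult_iff[OF field_poly_irreducible_imp_prime[OF irreducible]])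

lemma P_dvd_power: "P dvd a ^ n \<Longrightarrow> P dvd a"
  by (induction n) (auto simp: P_dvd_mult_iff not_P_dvd_1)

lemma P_dvd_prod: "finite I \<Longrightarrow> P dvd (\<Prod>i\<in>I. f i) \<Longrightarrow> \<exists>i\<in>I. P dvd f i"
  by (induction I rule: finite_induct) (auto simp: P_dvd_mult_iff not_P_dvd_1)

lemma not_P_dvd_low_degree: "a \<in> low_degree degP \<Longrightarrow> a \<noteq> 0 \<Longrightarrow> \<not> P dvd a"
  using dvd_imp_degree_le[of P a] by (auto simp: low_degree_degree)

text \<open>
  For \<open>a\<close> prime to \<open>P\<close>, multiplication by \<open>a\<close> permutes the nonzero residues modulo \<open>P\<close>; compare the
  products of all of them before and after.
\<close>
lemma Fermat: "P dvd a ^ (q ^ degP) - a"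
proof (cases "P dvd a")
  case True
  then show ?thesis by (intro dvd_diff) (auto intro: dvd_trans dvd_power)
next
  case False
  let ?R = "low_degree degP - {0}"
  let ?f = "\<lambda>r. (a * r) mod P"
  have maps: "?f r \<in> ?R" if "r \<in> ?R" for r
  proof -
    have "\<not> P dvd a * r" using that False not_P_dvd_low_degree by (auto simp: P_dvd_mult_iff)
    then show ?thesis
      using degree_mod_less_degree[of P "a * r"] by (auto simp: low_degree_degree mod_eq_0_iff_dvd)
  qed
  have "inj_on ?f ?R"
  proof (rule inj_onI)
    fix r r' assume r: "r \<in> ?R" "r' \<in> ?R" "?f r = ?f r'"
    then have "P dvd a * (r - r')"
      by (simp add: mod_eq_dvd_iff right_diff_distrib)
    then have "P dvd r - r'" using False by (simp add: P_dvd_mult_iff)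
    moreover have "r - r' \<in> low_degree degP"
      using r by (auto simp: low_degree_def)
    ultimately show "r = r'" using not_P_dvd_low_degree by fastforce
  qed
  moreover have "?f ` ?R \<subseteq> ?R" by (rule image_subsetI) (rule maps)
  then have "?f ` ?R = ?R"
    by (rule card_subset_eq[OF finite_Diff[OF finite_low_degree] _ card_image[OF \<open>inj_on ?f ?R\<close>]])
  ultimately have "(\<Prod>r\<in>?R. r) = (\<Prod>r\<in>?R. ?f r)"
    using prod.reindex[of ?f ?R "\<lambda>r. r"] by simp
  then have "(\<Prod>r\<in>?R. r) mod P = (\<Prod>r\<in>?R. a * r) mod P"
    using mod_prod_eq[of "\<lambda>r. a * r" P ?R] by simp
  also have "(\<Prod>r\<in>?R. a * r) = a ^ card ?R * (\<Prod>r\<in>?R. r)"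
    by (simp add: prod.distrib)
  finally have "P dvd (a ^ card ?R - 1) * (\<Prod>r\<in>?R. r)"
    by (simp add: mod_eq_dvd_iff dvd_diff_commute algebra_simps)
  moreover have "\<not> P dvd (\<Prod>r\<in>?R. r)"
    using P_dvd_prod[of ?R "\<lambda>r. r"] not_P_dvd_low_degree by auto
  ultimately have "P dvd (a ^ card ?R - 1) * a"
    by (simp add: P_dvd_mult_iff)
  moreover have "Suc (card ?R) = q ^ degP"
    using card_low_degree[of degP] low_degree_def by (subst card_Suc_Diff1) auto
  ultimately show ?thesis
    by (metis left_diff_distrib mult.left_neutral power_Suc2)
qed

definition local_ring :: "'c set" where
  "local_ring = {oA a / oA b | a b. \<not> P dvd b}"

lemma local_ringI: "\<not> P dvd b \<Longrightarrow> oA a / oA b \<in> local_ring"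
  by (auto simp: local_ring_def)

lemma oA_in_local_ring: "oA a \<in> local_ring"
  using local_ringI[of 1 a] not_P_dvd_1 by simp

lemma inverse_in_local_ring: "\<not> P dvd b \<Longrightarrow> inverse (oA b) \<in> local_ring"
  using local_ringI[of b 1] by (simp add: inverse_eq_divide)

lemma is_subring_local_ring: "is_subring local_ring"
  unfolding is_subring_def
proof (intro conjI ballI)
  show "1 \<in> local_ring" using oA_in_local_ring[of 1] by simp
  fix x y assume "x \<in> local_ring" "y \<in> local_ring"
  then obtain a b c d where *: "x = oA a / oA b" "y = oA c / oA d" "\<not> P dvd b" "\<not> P dvd d"
    by (auto simp: local_ring_def)
  then have nz: "b \<noteq> 0" "d \<noteq> 0" and bd: "\<not> P dvd b * d" by (auto simp: P_dvd_mult_iff)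
  have "x - y = oA (a * d - c * b) / oA (b * d)"
    unfolding *(1,2) using nz by (simp add: oA_diff oA_mult diff_frac_eq)
  then show "x - y \<in> local_ring" using local_ringI[OF bd] by simp
  have "x * y = oA (a * c) / oA (b * d)"
    using * by (simp add: oA_mult)
  then show "x * y \<in> local_ring" using local_ringI[OF bd] by simp
qed

lemmas local_ring_closed = is_subring_closed[OF is_subring_local_ring]

lemma prod_in_local_ring: "(\<And>i. i \<in> I \<Longrightarrow> f i \<in> local_ring) \<Longrightarrow> (\<Prod>i\<in>I. f i) \<in> local_ring"
  by (induction I rule: infinite_finite_induct) (auto intro: local_ring_closed)

lemma local_ring_Fermat:
  assumes "x \<in> local_ring"
  shows "\<exists>y\<in>local_ring. x ^ (q ^ degP) - x = oA P * y"
proof -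
  obtain a b where x: "x = oA a / oA b" "\<not> P dvd b"
    using assms by (auto simp: local_ring_def)
  let ?Q = "q ^ degP"
  obtain u v where uv: "a ^ ?Q - a = P * u" "b ^ ?Q - b = P * v"
    using Fermat by (meson dvdE)
  have "a ^ ?Q * b - a * b ^ ?Q = (a ^ ?Q - a) * b - a * (b ^ ?Q - b)"
    by (simp add: algebra_simps)
  also have "\<dots> = P * (u * b - a * v)"
    unfolding uv by (simp add: algebra_simps)
  finally have "oA (a ^ ?Q * b - a * b ^ ?Q) = oA (P * (u * b - a * v))"
    by (rule arg_cong)
  then have 1: "oA a ^ ?Q * oA b - oA a * oA b ^ ?Q = oA P * oA (u * b - a * v)"
    by (simp only: oA_diff oA_mult oA_power)
  have nz: "oA b \<noteq> 0" using x by auto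
  have "z ^ n - z = (w ^ n * t - w * t ^ n) / (t ^ Suc n)" if "z = w / t" "t \<noteq> 0" for z w t :: 'c and n
    unfolding that(1) using that(2) by (simp add: power_divide field_simps)
  from this[OF x(1) nz, of ?Q] have "x ^ ?Q - x = oA P * (oA (u * b - a * v) / oA (b ^ Suc ?Q))"
    unfolding 1 by (simp only: oA_power times_divide_eq_right)
  moreover have "\<not> P dvd b ^ Suc ?Q" using x P_dvd_power by blast
  ultimately show ?thesis using local_ringI by blast
qed

lemma not_P_dvd_carlitz_D: "k < degP \<Longrightarrow> \<not> P dvd carlitz_D k"
proof
  assume k: "k < degP" and "P dvd carlitz_D k"
  then obtain a where a: "a \<in> low_degree k" "P dvd Polynomial.monom 1 k - a"
    using P_dvd_prod[of "low_degree k"] by (auto simp: carlitz_D_eq_prod)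
  have "Polynomial.monom 1 k - a \<in> low_degree degP"
    using a k by (auto simp: low_degree_def)
  moreover have "Polynomial.coeff (Polynomial.monom 1 k - a) k = 1"
    using a by (simp add: low_degree_def)
  then have "Polynomial.monom 1 k - a \<noteq> 0" by (metis coeff_0 zero_neq_one)
  ultimately show False using a not_P_dvd_low_degree by blast
qed

text \<open>
  This says \<open>C\<^sub>P(X) \<equiv> X^(q^d)\<close> modulo \<open>P\<close>: the factor at \<open>a = 0\<close> in \<open>D\<^sub>k \<psi>\<^sub>k(P) = \<Prod>(P - a)\<close> is \<open>P\<close>, while
  \<open>D\<^sub>k\<close> is a product of polynomials of degree \<open>k < d\<close> and hence prime to \<open>P\<close>.
\<close>
lemma psi_P_divisible:
  assumes "k < degP"
  shows "psi k (oA P) / oA P \<in> local_ring"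
proof -
  have "psi k (oA P) = oA P * (\<Prod>a\<in>low_degree k - {0}. oA P - oA a) / DC k"
    unfolding psi_factorization using prod.remove[of "low_degree k" 0 "\<lambda>a. oA P - oA a"]
    by (simp add: low_degree_degree)
  then have "psi k (oA P) / oA P = (\<Prod>a\<in>low_degree k - {0}. oA P - oA a) * inverse (DC k)"
    by (simp add: divide_inverse)
  then show ?thesis
    using not_P_dvd_carlitz_D[OF assms]
    by (simp add: local_ring_closed prod_in_local_ring oA_in_local_ring inverse_in_local_ring)
qed

text \<open>
  \<open>\<theta>^(q^i) - \<theta>\<close> is squarefree for \<open>i > 0\<close>, because its derivative is \<open>-1\<close>.
\<close>
lemma not_P2_dvd_bracket: "\<not> P ^ 2 dvd Polynomial.monom 1 (q ^ Suc i) - Polynomial.monom 1 1"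
proof
  assume "P ^ 2 dvd Polynomial.monom 1 (q ^ Suc i) - Polynomial.monom 1 1"
  then obtain u where u: "Polynomial.monom 1 (q ^ Suc i) - Polynomial.monom 1 1 = P * P * u"
    by (auto simp: power2_eq_square dvd_def)
  have "of_nat q = (0 :: 'q)"
  proof -
    have "of_nat (q choose 1) = (0 :: 'q)"
      using q_power_additive_finite_field[where ?'q = 'q] q_ge_2
      unfolding q_power_additive_def card_q by auto
    then show ?thesis by simp
  qed
  then have "pderiv (Polynomial.monom 1 (q ^ Suc i) - Polynomial.monom 1 1) = (- 1 :: 'q poly)"
    by (simp add: pderiv_diff pderiv_monom one_pCons monom_0)
  moreover have "P dvd pderiv (P * P * u)"
    by (simp add: pderiv_mult)
  ultimately have "P dvd - 1" by (simp only: u)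
  then show False using not_P_dvd_1 by simp
qed

lemma P_divide_bracket: "oA P / (\<theta> ^ (q ^ Suc i) - \<theta>) \<in> local_ring"
proof -
  let ?b = "Polynomial.monom 1 (q ^ Suc i) - Polynomial.monom 1 1 :: 'q poly"
  have b: "\<theta> ^ (q ^ Suc i) - \<theta> = oA ?b"
    by (simp add: oA_diff oA_monom_1)
  show ?thesis
  proof (cases "P dvd ?b")
    case False
    then show ?thesis unfolding b by (rule local_ringI)
  next
    case True
    then obtain u where u: "?b = P * u" by blast
    then have "\<not> P dvd u"
      using not_P2_dvd_bracket[of i] by (auto simp: power2_eq_square)
    moreover have "oA P / oA ?b = oA 1 / oA u"
      unfolding u by (simp add: oA_mult)
    ultimately show ?thesis unfolding b using local_ringI by metis
  qed
qed

text \<open>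
  \<open>D\<^sub>i\<close> has valuation at most \<open>q^i - 1\<close> at \<open>P\<close>: passing from \<open>i\<close> to \<open>i + 1\<close> multiplies the valuation by
  \<open>q\<close> and adds at most \<open>1 \<le> q - 1\<close>. Consequently \<open>exp\<^sub>C(P u)\<close> is divisible by \<open>P\<close> for integral \<open>u\<close>.
\<close>
lemma P_power_divide_carlitz_D: "oA P ^ (q ^ i - 1) / DC i \<in> local_ring"
proof (induction i)
  case 0
  then show ?case using oA_in_local_ring[of 1] by simp
next
  case (Suc i)
  have "q ^ Suc i - 1 = (q ^ i - 1) * q + (q - 2) + 1"
  proof -
    obtain r where "q ^ i = Suc r" using not0_implies_Suc[of "q ^ i"] by auto
    then show ?thesis using q_ge_2 by (simp add: algebra_simps)
  qed
  then have "oA P ^ (q ^ Suc i - 1) / DC (Suc i) =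
     (oA P ^ (q ^ i - 1) / DC i) ^ q * oA P ^ (q - 2) * (oA P / (\<theta> ^ (q ^ Suc i) - \<theta>))"
    unfolding DC_Suc by (simp only: power_add power_mult power_divide power_one_right) simp
  then show ?case
    using Suc P_divide_bracket by (simp only: local_ring_closed oA_in_local_ring)
qed

abbreviation local_polys :: "nat \<Rightarrow> 'c mpoly set" where
  "local_polys s \<equiv> mpolys local_ring s"

lemmas local_polys_closed =
  mpolys_mconst[OF is_subring_local_ring] mpolys_0[OF is_subring_local_ring] mpolys_1[OF is_subring_local_ring]
  mpolys_mvar[OF is_subring_local_ring] mpolys_add[OF is_subring_local_ring]
  mpolys_sum[OF is_subring_local_ring] mpolys_mult[OF is_subring_local_ring]
  mpolys_diff[OF is_subring_local_ring] mpolys_minus[OF is_subring_local_ring] mpolys_power[OF is_subring_local_ring]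
  mpolys_prod[OF is_subring_local_ring] mpolys_msubst[OF is_subring_local_ring]
  mpolys_monom_subst[OF is_subring_local_ring]

definition P_multiples :: "nat \<Rightarrow> 'c mpoly set" where
  "P_multiples s = (\<lambda>F. mconst (oA P) * F) ` local_polys s"

lemma P_multiples_add: "F \<in> P_multiples s \<Longrightarrow> G \<in> P_multiples s \<Longrightarrow> F + G \<in> P_multiples s"
  by (auto simp: P_multiples_def distrib_left[symmetric] intro!: imageI local_polys_closed)

lemma P_multiples_0: "0 \<in> P_multiples s"
  unfolding P_multiples_def by (rule image_eqI[of _ _ 0]) (auto intro: local_polys_closed)

lemma P_multiples_sum: "(\<And>i. i \<in> I \<Longrightarrow> f i \<in> P_multiples s) \<Longrightarrow> (\<Sum>i\<in>I. f i) \<in> P_multiples s"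
  by (induction I rule: infinite_finite_induct) (auto intro: P_multiples_add P_multiples_0)

lemma P_multiples_mult: "F \<in> P_multiples s \<Longrightarrow> G \<in> local_polys s \<Longrightarrow> F * G \<in> P_multiples s"
  by (auto simp: P_multiples_def mult.assoc intro!: imageI local_polys_closed)

lemma P_multiples_mconst_mult:
  assumes "c / oA P \<in> local_ring" "F \<in> local_polys s"
  shows "mconst c * F \<in> P_multiples s"
  unfolding P_multiples_def
proof (rule image_eqI)
  show "mconst c * F = mconst (oA P) * (mconst (c / oA P) * F)"
    by (simp add: mult.assoc[symmetric] mconst_mult[symmetric])
  show "mconst (c / oA P) * F \<in> local_polys s"
    using assms by (intro local_polys_closed)
qed

lemma P_multiples_minus: "F \<in> P_multiples s \<Longrightarrow> - F \<in> P_multiples s"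
  using P_multiples_mult[of F s "- 1"] by (simp add: local_polys_closed)

lemma P_multiples_mult_cong:
  assumes "F - F' \<in> P_multiples s" "G - G' \<in> P_multiples s" "F' \<in> local_polys s" "G \<in> local_polys s"
  shows "F * G - F' * G' \<in> P_multiples s"
proof -
  have "(F - F') * G + (G - G') * F' \<in> P_multiples s"
    using assms by (intro P_multiples_add P_multiples_mult)
  then show ?thesis by (simp add: algebra_simps)
qed

lemma P_multiples_power_cong:
  assumes "F - F' \<in> P_multiples s" "F \<in> local_polys s" "F' \<in> local_polys s"
  shows "F ^ n - F' ^ n \<in> P_multiples s"
  using assms
  by (induction n) (auto intro!: P_multiples_mult_cong local_polys_closed P_multiples_0)

lemma P_multiples_prod_cong:
  assumes "\<And>i. i \<in> I \<Longrightarrow> F i - F' i \<in> P_multiples s"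
    "\<And>i. i \<in> I \<Longrightarrow> F i \<in> local_polys s" "\<And>i. i \<in> I \<Longrightarrow> F' i \<in> local_polys s"
  shows "(\<Prod>i\<in>I. F i) - (\<Prod>i\<in>I. F' i) \<in> P_multiples s"
  using assms
  by (induction I rule: infinite_finite_induct)
     (auto intro!: P_multiples_mult_cong local_polys_closed P_multiples_0)

lemma P_multiples_cancel:
  assumes "mconst (oA P) * F \<in> P_multiples s"
  shows "F \<in> local_polys s"
proof -
  obtain G where G: "mconst (oA P) * F = mconst (oA P) * G" "G \<in> local_polys s"
    using assms by (auto simp: P_multiples_def)
  then have "mconst (inverse (oA P) * oA P) * F = mconst (inverse (oA P) * oA P) * G"
    by (simp only: mconst_mult mult.assoc)
  then show ?thesis using G by simp
qed

lemma psi_P_eq: "k \<ge> degP \<Longrightarrow> psi k (oA P) = (if k = degP then 1 else 0)"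
  using monic by (auto simp: psi_oA \<iota>_one coeff_eq_0)

lemma carlitz_var_P_cong:
  assumes "i \<in> {1..s}"
  shows "carlitz_var \<iota> P i - mvar i ^ (q ^ degP) \<in> P_multiples s"
proof -
  have "carlitz_var \<iota> P i - mvar i ^ (q ^ degP) = (\<Sum>k<degP. mconst (psi k (oA P)) * mvar i ^ (q ^ k))"
    unfolding carlitz_var_eq carlitz_eval_eq_sum[OF order_refl] lessThan_Suc_atMost[symmetric]
    by (simp add: psi_P_eq)
  also have "\<dots> \<in> P_multiples s"
    using assms psi_P_divisible
    by (intro P_multiples_sum P_multiples_mconst_mult local_polys_closed) auto
  finally show ?thesis .
qed

lemma carlitz_var_local: "i \<in> {1..s} \<Longrightarrow> carlitz_var \<iota> a i \<in> local_polys s"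
  using oA_in_local_ring by (intro carlitz_var_in_mpolys is_subring_local_ring) auto

text \<open>
  On coefficients this is Fermat's theorem, on variables the congruence \<open>C\<^sub>P(X) \<equiv> X^(q^d)\<close>.
\<close>
lemma Frobenius_lift:
  assumes F: "F \<in> local_polys s"
  shows "msubst (carlitz_var \<iota> P) F - F ^ (q ^ degP) \<in> P_multiples s"
proof -
  let ?Q = "q ^ degP" and ?c = "Poly_Mapping.lookup F"
  have mono: "monom_subst (carlitz_var \<iota> P) m - Poly_Mapping.single m 1 ^ ?Q \<in> P_multiples s"
    if "m \<in> Poly_Mapping.keys F" for m
  proof -
    have "Poly_Mapping.single m 1 ^ ?Q =
        (\<Prod>i\<in>Poly_Mapping.keys m. (mvar i ^ ?Q) ^ Poly_Mapping.lookup m i :: 'c mpoly)"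
      by (simp add: monom_subst_mvar[symmetric] monom_subst_def prod_power_distrib mult.commute
          flip: power_mult)
    then show ?thesis
      unfolding monom_subst_def using mpolys_keys[OF F that]
      by (auto intro!: P_multiples_prod_cong P_multiples_power_cong carlitz_var_P_cong
          local_polys_closed carlitz_var_local)
  qed
  have "F ^ ?Q = (\<Sum>m\<in>Poly_Mapping.keys F. (mconst (?c m) * Poly_Mapping.single m 1) ^ ?Q)"
    by (subst mpoly_eq_sum_single[of F]) (simp only: q_power_MP single_eq_mconst_mult[symmetric])
  then have "msubst (carlitz_var \<iota> P) F - F ^ ?Q =
     (\<Sum>m\<in>Poly_Mapping.keys F. mconst (?c m) * monom_subst (carlitz_var \<iota> P) m
        - mconst (?c m) ^ ?Q * Poly_Mapping.single m 1 ^ ?Q)"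
    by (simp add: msubst_def monom_subst_def power_mult_distrib sum_subtractf)
  also have "\<dots> \<in> P_multiples s"
  proof (rule P_multiples_sum)
    fix m assume m: "m \<in> Poly_Mapping.keys F"
    obtain y where y: "?c m ^ ?Q - ?c m = oA P * y" "y \<in> local_ring"
      using local_ring_Fermat mpolys_lookup[OF F] by blast
    have "?c m - ?c m ^ ?Q = oA P * (- y)"
      using y(1) by (simp add: algebra_simps)
    then have "mconst (?c m) - mconst (?c m) ^ ?Q = mconst (oA P) * mconst (- y)"
      by (metis mconst_diff mconst_mult mconst_power)
    then have "mconst (?c m) - mconst (?c m) ^ ?Q \<in> P_multiples s"
      using y(2) by (auto simp: P_multiples_def intro!: imageI local_polys_closed local_ring_closed)
    then show "mconst (?c m) * monom_subst (carlitz_var \<iota> P) m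
        - mconst (?c m) ^ ?Q * Poly_Mapping.single m 1 ^ ?Q \<in> P_multiples s"
      using mono[OF m] mpolys_lookup[OF F] mpolys_keys[OF F m]
      by (intro P_multiples_mult_cong local_polys_closed carlitz_var_local) auto
  qed
  finally show ?thesis .
qed

definition prime_to_P_sum :: "'c mpoly \<Rightarrow> nat \<Rightarrow> 'c mpoly" where
  "prime_to_P_sum F d = (\<Sum>a\<in>{a \<in> monic_of_degree d. \<not> P dvd a}.
     mconst (inverse (oA a)) * msubst (carlitz_var \<iota> a) F)"

lemma P_multiples_of_degree:
  "{a \<in> monic_of_degree d. P dvd a} = (if degP \<le> d then (\<lambda>b. P * b) ` monic_of_degree (d - degP) else {})"
proof (intro Set.set_eqI iffI)
  fix a assume a: "a \<in> {a \<in> monic_of_degree d. P dvd a}"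
  then obtain b where b: "a = P * b" by blast
  with a have "b \<noteq> 0" "Polynomial.lead_coeff b = 1"
    using lead_coeff_mult[of P b] monic by (auto simp: monic_of_degree_def)
  then show "a \<in> (if degP \<le> d then (\<lambda>b. P * b) ` monic_of_degree (d - degP) else {})"
    using a b by (auto simp: monic_of_degree_def degree_mult_eq)
next
  fix a assume "a \<in> (if degP \<le> d then (\<lambda>b. P * b) ` monic_of_degree (d - degP) else {})"
  then obtain b where b: "a = P * b" "b \<in> monic_of_degree (d - degP)" "degP \<le> d"
    by (auto split: if_splits)
  then have "b \<noteq> 0" by (auto simp: monic_of_degree_def)
  then have "Polynomial.degree a = d"
    using b by (auto simp: monic_of_degree_def degree_mult_eq)
  moreover have "Polynomial.lead_coeff b = 1" using b by (auto simp: monic_of_degree_def)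
  then have "Polynomial.lead_coeff a = 1"
    unfolding b(1) lead_coeff_mult monic by simp
  ultimately have "a \<in> monic_of_degree d" by (simp add: monic_of_degree_def)
  then show "a \<in> {a \<in> monic_of_degree d. P dvd a}"
    using b by simp
qed

text \<open>
  For \<open>a = P a'\<close> one has \<open>F(C\<^sub>a(X)) / a = \<phi>(F(C\<^sub>a\<^sub>'(X)) / a') / P\<close> with \<open>\<phi>: X\<^sub>i \<mapsto> C\<^sub>P(X\<^sub>i)\<close>.
\<close>
lemma carlitz_sum_split:
  "mconst (oA P) * carlitz_sum F d = mconst (oA P) * prime_to_P_sum F d +
     (if degP \<le> d then msubst (carlitz_var \<iota> P) (carlitz_sum F (d - degP)) else 0)"
proof -
  let ?t = "\<lambda>a. mconst (inverse (oA a)) * msubst (carlitz_var \<iota> a) F"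
  have "carlitz_sum F d = prime_to_P_sum F d + (\<Sum>a\<in>{a \<in> monic_of_degree d. P dvd a}. ?t a)"
    unfolding carlitz_sum_def prime_to_P_sum_def
    by (subst sum.union_disjoint[symmetric]) (auto intro: sum.cong)
  moreover have "mconst (oA P) * (\<Sum>a\<in>{a \<in> monic_of_degree d. P dvd a}. ?t a) =
      (if degP \<le> d then msubst (carlitz_var \<iota> P) (carlitz_sum F (d - degP)) else 0)"
  proof (cases "degP \<le> d")
    case True
    have "mconst (oA P) * ?t (P * b) = mconst (inverse (oA b)) * msubst (carlitz_var \<iota> P) (msubst (carlitz_var \<iota> b) F)" for b
    proof -
      have "msubst (carlitz_var \<iota> P) (msubst (carlitz_var \<iota> b) F) = msubst (carlitz_var \<iota> (P * b)) F"
        by (simp add: msubst_msubst carlitz_var_eq[abs_def] msubst_carlitz_eval mult.commute[of P b]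
            carlitz_eval_mult fun_eq_iff)
      moreover have "oA P * inverse (oA (P * b)) = inverse (oA b)"
        by (simp add: oA_mult)
      ultimately show ?thesis
        by (metis mconst_mult mult.assoc)
    qed
    moreover have "inj_on (\<lambda>b. P * b) S" for S by (auto simp: inj_on_def)
    ultimately show ?thesis
      using True unfolding P_multiples_of_degree
      by (simp add: sum.reindex sum_distrib_left carlitz_sum_def msubst_sum msubst_mult)
  qed (simp add: P_multiples_of_degree)
  ultimately show ?thesis by (simp add: distrib_left)
qed

text \<open>
  By the splitting of \<open>P S\<^sub>k\<close> and the functional equation for \<open>exp\<^sub>C(P G)\<close>,
  \<open>\<Sum>\<^sub>k \<psi>\<^sub>k(P) E\<^sub>n\<^sub>-\<^sub>k^(q^k) = \<Sum>\<^sub>i (P u\<^sub>n\<^sub>-\<^sub>i)^(q^i) / D\<^sub>i + \<phi>(E\<^sub>n\<^sub>-\<^sub>d)\<close>. Here \<open>\<psi>\<^sub>0(P) = P\<close>, \<open>\<psi>\<^sub>k(P)\<close> is divisible by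
  \<open>P\<close> for \<open>k < d\<close>, and \<open>\<psi>\<^sub>d(P) = 1\<close>. Hence \<open>P E\<^sub>n\<close> is a multiple of \<open>P\<close> if the earlier \<open>E\<^sub>k\<close> are
  integral, because \<open>\<phi>(E\<^sub>n\<^sub>-\<^sub>d) \<equiv> E\<^sub>n\<^sub>-\<^sub>d^(q^d)\<close>.
\<close>
lemma L_coeff_local:
  assumes F: "F \<in> local_polys s"
  shows "L_coeff F n \<in> local_polys s"
proof (induction n rule: less_induct)
  case (less n)
  let ?\<phi> = "msubst (carlitz_var \<iota> P)" and ?y = "L_coeff F"
  have u: "prime_to_P_sum F d \<in> local_polys s" for d
    unfolding prime_to_P_sum_def
    by (intro local_polys_closed inverse_in_local_ring carlitz_var_local F) auto
  \<comment> \<open>\<open>\<phi>\<close> is a ring homomorphism over \<open>\<C>\<^sub>\<infinity>\<close>, so it commutes with the formation of \<open>E\<^sub>n\<close>; shifting the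
    sequence \<open>S\<close> by \<open>d\<close> shifts \<open>E\<close> by \<open>d\<close>.\<close>
  have \<phi>: "(\<Sum>i\<le>n. mconst (inverse (DC i)) * (if degP \<le> n - i then ?\<phi> (carlitz_sum F (n - i - degP)) else 0) ^ (q ^ i))
      = (if degP \<le> n then ?\<phi> (?y (n - degP)) else 0)"
  proof (cases "degP \<le> n")
    case True
    have "(\<Sum>i\<le>n. mconst (inverse (DC i)) * (if degP \<le> n - i then ?\<phi> (carlitz_sum F (n - i - degP)) else 0) ^ (q ^ i))
       = (\<Sum>i\<le>n - degP. mconst (inverse (DC i)) * ?\<phi> (carlitz_sum F (n - degP - i)) ^ (q ^ i))"
      using True by (intro sum.mono_neutral_cong_right) (auto simp: zero_power add.commute)
    then show ?thesis
      using True by (simp add: L_coeff_def exp_coeff_def msubst_sum msubst_mult msubst_power)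
  next
    case False
    then show ?thesis by (auto simp: zero_power intro!: sum.neutral)
  qed
  have "exp_coeff (\<lambda>d. mconst (oA P) * carlitz_sum F d) n =
     (\<Sum>i\<le>n. mconst (inverse (DC i)) * (mconst (oA P) * prime_to_P_sum F (n - i)) ^ (q ^ i))
      + (if degP \<le> n then ?\<phi> (?y (n - degP)) else 0)"
    unfolding carlitz_sum_split exp_coeff_add \<phi>[symmetric] by (simp add: exp_coeff_def)
  \<comment> \<open>The term \<open>k = 0\<close>, with \<open>\<psi>\<^sub>0(P) = P\<close>, is the one to solve for.\<close>
  moreover have "exp_coeff (\<lambda>d. mconst (oA P) * carlitz_sum F d) n =
     mconst (oA P) * ?y n + (\<Sum>k\<in>{1..n}. mconst (psi k (oA P)) * ?y (n - k) ^ (q ^ k))"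
    unfolding exp_coeff_scalar_mult L_coeff_def atMost_atLeast0
    by (subst sum.atLeast_Suc_atMost) auto
  moreover have "(\<Sum>k\<in>{1..n}. mconst (psi k (oA P)) * ?y (n - k) ^ (q ^ k)) =
     (\<Sum>k\<in>{1..n} \<inter> {..<degP}. mconst (psi k (oA P)) * ?y (n - k) ^ (q ^ k))
      + (if degP \<le> n then ?y (n - degP) ^ (q ^ degP) else 0)"
  proof -
    have "(\<Sum>k\<in>{1..n}. mconst (psi k (oA P)) * ?y (n - k) ^ (q ^ k)) =
       (\<Sum>k\<in>{1..n} \<inter> {..<degP}. mconst (psi k (oA P)) * ?y (n - k) ^ (q ^ k))
       + (\<Sum>k\<in>{1..n} \<inter> {degP..}. mconst (psi k (oA P)) * ?y (n - k) ^ (q ^ k))"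
      by (subst sum.union_disjoint[symmetric]) (auto intro: sum.cong)
    also have "(\<Sum>k\<in>{1..n} \<inter> {degP..}. mconst (psi k (oA P)) * ?y (n - k) ^ (q ^ k)) =
       (\<Sum>k\<in>{1..n} \<inter> {degP..}. if k = degP then ?y (n - degP) ^ (q ^ degP) else 0)"
      by (rule sum.cong) (auto simp: psi_P_eq)
    also have "\<dots> = (if degP \<le> n then ?y (n - degP) ^ (q ^ degP) else 0)"
      using degP_pos by (auto simp: Suc_le_eq)
    finally show ?thesis .
  qed
  ultimately have "mconst (oA P) * ?y n =
     (\<Sum>i\<le>n. mconst (inverse (DC i)) * (mconst (oA P) * prime_to_P_sum F (n - i)) ^ (q ^ i))
     + (if degP \<le> n then ?\<phi> (?y (n - degP)) - ?y (n - degP) ^ (q ^ degP) else 0)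
     + - (\<Sum>k\<in>{1..n} \<inter> {..<degP}. mconst (psi k (oA P)) * ?y (n - k) ^ (q ^ k))"
    by (simp add: algebra_simps split: if_splits)
  also have "\<dots> \<in> P_multiples s"
  proof (intro P_multiples_add P_multiples_minus)
    show "(\<Sum>k\<in>{1..n} \<inter> {..<degP}. mconst (psi k (oA P)) * ?y (n - k) ^ (q ^ k)) \<in> P_multiples s"
      using less psi_P_divisible
      by (intro P_multiples_sum P_multiples_mconst_mult local_polys_closed) auto
    show "(if degP \<le> n then ?\<phi> (?y (n - degP)) - ?y (n - degP) ^ (q ^ degP) else 0) \<in> P_multiples s"
      using less degP_pos by (auto intro!: Frobenius_lift P_multiples_0)
    show "(\<Sum>i\<le>n. mconst (inverse (DC i)) * (mconst (oA P) * prime_to_P_sum F (n - i)) ^ (q ^ i)) \<in> P_multiples s"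
    proof (rule P_multiples_sum)
      fix i
      have "mconst (inverse (DC i)) * (mconst (oA P) * prime_to_P_sum F (n - i)) ^ (q ^ i) =
        mconst (inverse (DC i) * oA P ^ (q ^ i)) * prime_to_P_sum F (n - i) ^ (q ^ i)"
        by (simp add: mconst_mult mconst_power power_mult_distrib mult.assoc)
      moreover have "inverse (DC i) * oA P ^ (q ^ i) / oA P \<in> local_ring"
        using P_power_divide_carlitz_D[of i] one_le_power[of q i] q_ge_2
        by (simp add: power_diff divide_inverse mult.commute mult.left_commute)
      ultimately show "mconst (inverse (DC i)) * (mconst (oA P) * prime_to_P_sum F (n - i)) ^ (q ^ i) \<in> P_multiples s"
        using u by (auto intro!: P_multiples_mconst_mult local_polys_closed)
    qed
  qed
  finally show ?case by (rule P_multiples_cancel)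
qed

end

lemma monic_irreducible_factor:
  fixes b :: "'q poly"
  assumes "Polynomial.degree b > 0"
  shows "\<exists>P. Factorial_Ring.irreducible P \<and> Polynomial.lead_coeff P = 1 \<and> P dvd b"
  using assms
proof (induction "Polynomial.degree b" arbitrary: b rule: less_induct)
  case less
  show ?case
  proof (cases "Factorial_Ring.irreducible b")
    case True
    let ?P = "Polynomial.smult (inverse (Polynomial.lead_coeff b)) b"
    have nz: "Polynomial.lead_coeff b \<noteq> 0" using less by auto
    have "Factorial_Ring.irreducible ?P"
      using True nz irreducible_mult_unit_left[of "[:inverse (Polynomial.lead_coeff b):]" b]
      by (simp add: is_unit_triv)
    moreover have "?P dvd b" using nz by (simp add: smult_dvd_iff)
    ultimately show ?thesis using nz by (intro exI[of _ ?P]) auto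
  next
    case False
    moreover have "b \<noteq> 0" using less by auto
    then have "\<not> b dvd 1" using less by (simp add: is_unit_iff_degree)
    ultimately obtain x y where xy: "b = x * y" "\<not> x dvd 1" "\<not> y dvd 1"
      using less by (auto simp: Factorial_Ring.irreducible_def)
    then have "x \<noteq> 0" "y \<noteq> 0" using less by auto
    then have "Polynomial.degree x > 0" "Polynomial.degree y > 0"
      using xy by (auto simp: is_unit_iff_degree)
    moreover from this have "Polynomial.degree x < Polynomial.degree b"
      using xy \<open>x \<noteq> 0\<close> \<open>y \<noteq> 0\<close> by (simp add: degree_mult_eq)
    ultimately show ?thesis using less.hyps[of x] xy by auto
  qed
qed

text \<open>
  In a fraction whose denominator has least degree, no prime can divide the denominator.
\<close>
lemma Inter_local_rings:
  assumes "\<And>P. Factorial_Ring.irreducible P \<Longrightarrow> Polynomial.lead_coeff P = 1 \<Longrightarrow> x \<in> local_ring P"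
  shows "x \<in> range oA"
proof -
  obtain P :: "'q poly" where P: "Factorial_Ring.irreducible P" "Polynomial.lead_coeff P = 1"
    using monic_irreducible_factor[of "[:0, 1:]"] by auto
  then have "x \<in> local_ring P" by (rule assms)
  then obtain a b where "\<not> P dvd b" "x = oA a / oA b"
    by (auto simp: local_ring_def[OF P])
  then have "\<exists>a b. b \<noteq> 0 \<and> x = oA a / oA b"
    by (metis dvd_0_right)
  then obtain b where b: "b \<noteq> 0" "\<exists>a. x = oA a / oA b"
    and min: "\<And>b'. b' \<noteq> 0 \<and> (\<exists>a. x = oA a / oA b') \<Longrightarrow> Polynomial.degree b \<le> Polynomial.degree b'"
    using ex_has_least_nat[of "\<lambda>b. b \<noteq> 0 \<and> (\<exists>a. x = oA a / oA b)" _ Polynomial.degree] by blast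
  obtain a where a: "x = oA a / oA b" using b by blast
  have "Polynomial.degree b = 0"
  proof (rule ccontr)
    assume "Polynomial.degree b \<noteq> 0"
    then obtain P where P: "Factorial_Ring.irreducible P" "Polynomial.lead_coeff P = 1" "P dvd b"
      using monic_irreducible_factor by auto
    obtain a' b' where x: "x = oA a' / oA b'" "\<not> P dvd b'"
      using assms[OF P(1,2)] by (auto simp: local_ring_def[OF P(1,2)])
    have nz: "oA b \<noteq> 0" "oA b' \<noteq> 0" using b x by auto
    have "oA a / oA b = oA a' / oA b'" using a x by simp
    then have "oA (a * b') = oA (a' * b)"
      unfolding oA_mult by (rule iffD1[OF frac_eq_eq[OF nz]])
    then have "a * b' = a' * b" by (simp only: oA_eq_iff)
    then have "P dvd a * b'" using P by simp
    then have "P dvd a" using x P_dvd_mult_iff[OF P(1,2)] by auto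
    then obtain c d where cd: "a = P * c" "b = P * d" using P by (auto elim!: dvdE)
    then have "d \<noteq> 0" "P \<noteq> 0" using b by auto
    moreover have "x = oA c / oA d" using a \<open>P \<noteq> 0\<close> by (simp add: cd oA_mult)
    ultimately have "Polynomial.degree b \<le> Polynomial.degree d" using min by blast
    moreover have "Polynomial.degree b = Polynomial.degree P + Polynomial.degree d"
      using cd \<open>d \<noteq> 0\<close> \<open>P \<noteq> 0\<close> by (simp add: degree_mult_eq)
    ultimately show False using degP_pos[OF P(1,2)] by simp
  qed
  then obtain c where c: "b = [:c:]" by (auto elim: degree_eq_zeroE)
  with b have "c \<noteq> 0" by auto
  have "oA (Polynomial.smult (inverse c) a) * oA b = oA a"
    using \<open>c \<noteq> 0\<close> by (simp add: c oA_mult[symmetric] del: oA_const)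
  moreover have "oA b \<noteq> 0" using b by simp
  ultimately have "x = oA (Polynomial.smult (inverse c) a)"
    unfolding a by (metis nonzero_mult_div_cancel_right)
  then show ?thesis by blast
qed

lemma L_coeff_integral:
  assumes F: "F \<in> mpolys (range oA) s"
  shows "L_coeff F n \<in> mpolys (range oA) s"
proof -
  have l: "L_coeff F n \<in> mpolys (local_ring P) s" if "Factorial_Ring.irreducible P" "Polynomial.lead_coeff P = 1" for P
    using F oA_in_local_ring[OF that] mpolys_mono[of "range oA" "local_ring P" s]
    by (intro L_coeff_local[OF that]) blast
  have "L_coeff F n \<in> mpolys UNIV s"
    using F mpolys_mono[of "range oA" UNIV s] by (intro L_coeff_UNIV) blast
  then show ?thesis
    using Inter_local_rings mpolys_lookup[OF l] by (simp add: mpolys_def)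
qed

end

section \<open>The coefficients of the power series\<close>

lemma fps_nth_suminf:
  fixes f :: "nat \<Rightarrow> 'a::comm_ring_1 fps"
  assumes "\<And>i n. n < i \<Longrightarrow> fps_nth (f i) n = 0"
  shows "fps_nth (suminf f) n = (\<Sum>i\<le>n. fps_nth (f i) n)"
proof -
  define g where "g = Abs_fps (\<lambda>n. \<Sum>i\<le>n. fps_nth (f i) n)"
  have "f sums g"
    unfolding sums_def
  proof (rule tendsto_fpsI)
    fix n
    show "\<forall>\<^sub>F N in sequentially. fps_nth (\<Sum>i<N. f i) n = fps_nth g n"
      using eventually_gt_at_top[of n]
    proof eventually_elim
      case (elim N)
      have "fps_nth (\<Sum>i<N. f i) n = (\<Sum>i<N. fps_nth (f i) n)"
        by (simp add: fps_sum_nth)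
      also have "\<dots> = (\<Sum>i\<le>n. fps_nth (f i) n)"
        using elim assms by (intro sum.mono_neutral_right) auto
      finally show ?case by (simp add: g_def)
    qed
  qed
  then have "suminf f = g" by (rule sums_unique[symmetric])
  then show ?thesis by (simp add: g_def)
qed

text \<open>
  Additivity of the \<open>q^i\<close>-th power applied to the terms of degree at most \<open>n\<close>; the rest is divisible
  by \<open>Z^((n+1) q^i)\<close>.
\<close>
lemma fps_nth_q_power:
  fixes G :: "'a::comm_ring_1 fps"
  assumes q: "q_power_additive TYPE('a) q"
  shows "fps_nth (G ^ (q ^ i)) n = (if q ^ i dvd n then fps_nth G (n div q ^ i) ^ (q ^ i) else 0)"
proof -
  let ?Q = "q ^ i"
  have Q: "?Q > 0" using q by (simp add: q_power_additive_def)
  have "G = (\<Sum>j\<le>n. fps_const (fps_nth G j) * fps_X ^ j) + fps_X ^ Suc n * fps_shift (Suc n) G"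
  proof (rule fps_ext)
    fix k
    show "fps_nth G k = fps_nth ((\<Sum>j\<le>n. fps_const (fps_nth G j) * fps_X ^ j) + fps_X ^ Suc n * fps_shift (Suc n) G) k"
      by (simp add: fps_sum_nth fps_X_power_nth fps_X_power_mult_nth mult_delta_right del: power_Suc)
  qed
  then have "G ^ ?Q = (\<Sum>j\<le>n. fps_const (fps_nth G j) * fps_X ^ j) ^ ?Q + (fps_X ^ Suc n * fps_shift (Suc n) G) ^ ?Q"
    by (metis q_power_add[OF q_power_additive_fps[OF q]])
  also have "\<dots> = (\<Sum>j\<le>n. fps_const (fps_nth G j ^ ?Q) * fps_X ^ (j * ?Q)) + fps_X ^ (Suc n * ?Q) * fps_shift (Suc n) G ^ ?Q"
    by (simp add: q_power_sum[OF q_power_additive_fps[OF q]] power_mult_distrib fps_const_power power_mult del: power_Suc mult_Suc)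
  finally have "fps_nth (G ^ ?Q) n = (\<Sum>j\<le>n. if n = j * ?Q then fps_nth G j ^ ?Q else 0)"
  proof -
    assume *: "G ^ ?Q = (\<Sum>j\<le>n. fps_const (fps_nth G j ^ ?Q) * fps_X ^ (j * ?Q)) + fps_X ^ (Suc n * ?Q) * fps_shift (Suc n) G ^ ?Q"
    have "n < Suc n * ?Q" using Q by (metis lessI less_le_trans mult.right_neutral mult_le_mono2 Suc_leI One_nat_def)
    then show ?thesis
      unfolding * by (auto simp: fps_sum_nth fps_X_power_nth fps_X_power_mult_nth mult_delta_right
          simp del: mult_Suc intro!: sum.cong)
  qed
  also have "\<dots> = (if ?Q dvd n then fps_nth G (n div ?Q) ^ ?Q else 0)"
  proof (cases "?Q dvd n")
    case True
    then have "n = j * ?Q \<longleftrightarrow> j = n div ?Q" for j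
      using Q by (metis dvd_div_mult_self nonzero_mult_div_cancel_right less_irrefl)
    then show ?thesis using True by (simp add: sum.delta)
  qed (auto intro!: sum.neutral)
  finally show ?thesis .
qed

context carlitz_complex_q
begin

lemma less_q_power: "i < q ^ i"
  using less_exp[of i] power_mono[of 2 q i] q_ge_2 by linarith

lemma carlitz_L_nth_q_power: "fps_nth (carlitz_L \<iota> F) (q ^ n) = L_coeff F n"
  and carlitz_L_nth_other: "(\<And>n. N \<noteq> q ^ n) \<Longrightarrow> fps_nth (carlitz_L \<iota> F) N = 0"
proof -
  define G where "G = suminf (\<lambda>d. fps_X ^ (q ^ d) * fps_const (carlitz_sum F d))"
  have X: "fps_nth (fps_X ^ k * fps_const c) n = (if n = k then c else 0)" for k n and c :: "'c mpoly"
    by (auto simp: fps_X_power_mult_nth)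
  have G: "fps_nth G N = (\<Sum>d\<le>N. if N = q ^ d then carlitz_sum F d else 0)" for N
    unfolding G_def
  proof (subst fps_nth_suminf)
    fix i n :: nat assume "n < i"
    then have "n \<noteq> q ^ i" using less_q_power[of i] by simp
    then show "fps_nth (fps_X ^ q ^ i * fps_const (carlitz_sum F i)) n = 0" by (simp add: X)
  qed (simp only: X)
  have G1: "fps_nth G (q ^ d) = carlitz_sum F d" for d
    unfolding G using less_q_power[of d] by (simp add: q_power_eq_iff)
  have G0: "fps_nth G N = 0" if "\<And>d. N \<noteq> q ^ d" for N
    unfolding G using that by simp
  have G00: "fps_nth G 0 = 0" by (rule G0) simp
  have L: "carlitz_L \<iota> F = suminf (\<lambda>i. fps_const (mconst (inverse (DC i))) * G ^ (q ^ i))"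
    by (simp add: carlitz_L_def carlitz_exp_def G_def carlitz_sum_def)
  have nth: "fps_nth (carlitz_L \<iota> F) N = (\<Sum>i\<le>N. mconst (inverse (DC i)) *
      (if q ^ i dvd N then fps_nth G (N div q ^ i) ^ (q ^ i) else 0))" for N
    unfolding L
  proof (subst fps_nth_suminf)
    fix i n :: nat assume "n < i"
    then have "n < q ^ i" using less_q_power[of i] by simp
    then show "fps_nth (fps_const (mconst (inverse (DC i))) * G ^ (q ^ i)) n = 0"
      using startsby_zero_power_prefix[OF G00] by simp
  qed (simp add: fps_nth_q_power[OF q_power_additive_MP])
  show "fps_nth (carlitz_L \<iota> F) (q ^ n) = L_coeff F n"
  proof -
    have "fps_nth (carlitz_L \<iota> F) (q ^ n) = (\<Sum>i\<le>n. mconst (inverse (DC i)) *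
      (if q ^ i dvd q ^ n then fps_nth G (q ^ n div q ^ i) ^ (q ^ i) else 0))"
      unfolding nth using less_q_power[of n] q_ge_2
      by (intro sum.mono_neutral_right) (auto simp: dvd_power_iff_le)
    also have "\<dots> = (\<Sum>i\<le>n. mconst (inverse (DC i)) * carlitz_sum F (n - i) ^ (q ^ i))"
      using q_ge_2 by (intro sum.cong) (auto simp: le_imp_power_dvd G1 simp flip: power_diff)
    finally show ?thesis by (simp add: L_coeff_def exp_coeff_def)
  qed
  show "fps_nth (carlitz_L \<iota> F) N = 0" if N: "\<And>n. N \<noteq> q ^ n"
    unfolding nth
  proof (intro sum.neutral ballI)
    fix i
    have "fps_nth G (N div q ^ i) = 0" if "q ^ i dvd N"
    proof (rule G0)
      show "N div q ^ i \<noteq> q ^ d" for d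
        using that N[of "d + i"] by (metis dvd_div_mult_self power_add)
    qed
    then show "mconst (inverse (DC i)) * (if q ^ i dvd N then fps_nth G (N div q ^ i) ^ (q ^ i) else 0) = 0"
      by (simp add: zero_power)
  qed
qed

section \<open>Integral values of the Carlitz polynomials\<close>

lemma is_subring_range_oA: "is_subring (range oA)"
  unfolding is_subring_def
  by (metis (no_types, lifting) oA_1 oA_diff oA_mult rangeE rangeI)

lemma K_in_C_I: "b \<noteq> 0 \<Longrightarrow> oA a / oA b \<in> K_in_C \<iota>"
  by (auto simp: K_in_C_def)

lemma oA_in_K: "oA a \<in> K_in_C \<iota>"
  using K_in_C_I[of 1 a] by simp

lemma is_subring_K: "is_subring (K_in_C \<iota>)"
  unfolding is_subring_def
proof (intro conjI ballI)
  show "1 \<in> K_in_C \<iota>" using oA_in_K[of 1] by simp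
  fix x y assume "x \<in> K_in_C \<iota>" "y \<in> K_in_C \<iota>"
  then obtain a b c d where *: "x = oA a / oA b" "y = oA c / oA d" "b \<noteq> 0" "d \<noteq> 0"
    by (auto simp: K_in_C_def)
  then have bd: "b * d \<noteq> 0" by simp
  have "x - y = oA (a * d - c * b) / oA (b * d)"
    unfolding *(1,2) using * by (simp add: oA_diff oA_mult diff_frac_eq)
  then show "x - y \<in> K_in_C \<iota>" using K_in_C_I[OF bd] by simp
  have "x * y = oA (a * c) / oA (b * d)"
    using * by (simp add: oA_mult)
  then show "x * y \<in> K_in_C \<iota>" using K_in_C_I[OF bd] by simp
qed

lemma K_divide: "x \<in> K_in_C \<iota> \<Longrightarrow> y \<in> K_in_C \<iota> \<Longrightarrow> x / y \<in> K_in_C \<iota>"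
proof -
  assume "x \<in> K_in_C \<iota>" "y \<in> K_in_C \<iota>"
  then obtain a b c d where *: "x = oA a / oA b" "y = oA c / oA d" "b \<noteq> 0" "d \<noteq> 0"
    by (auto simp: K_in_C_def)
  show ?thesis
  proof (cases "c = 0")
    case True
    then show ?thesis using * is_subring_closed(1)[OF is_subring_K] by simp
  next
    case False
    have "x / y = oA (a * d) / oA (b * c)" using * by (simp add: oA_mult)
    then show ?thesis using False * K_in_C_I[of "b * c"] by simp
  qed
qed

lemmas K_closed = is_subring_closed[OF is_subring_K]
lemmas A_closed = is_subring_closed[OF is_subring_range_oA]

lemma absC_monic_of_degree:
  assumes "a \<in> monic_of_degree n"
  shows "absC (oA a) = real q ^ n"
proof -
  have "Polynomial.degree a = n" using assms by (simp add: monic_of_degree_def)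
  then show ?thesis using absC_oA[OF monic_of_degree_nonzero[OF assms]] by simp
qed

lemma absC_DC: "absC (DC n) = (real q ^ n) ^ (q ^ n)"
proof -
  have "absC (oA (Polynomial.monom 1 n - a)) = real q ^ n" if "a \<in> low_degree n" for a
  proof -
    have "Polynomial.monom 1 n + (- a) \<in> monic_of_degree n"
      unfolding monic_of_degree_eq using that by (intro imageI) (auto simp: low_degree_def)
    then show ?thesis using absC_monic_of_degree by simp
  qed
  then show ?thesis
    by (simp add: carlitz_D_eq_prod oA_prod absC_prod card_low_degree)
qed

lemma absC_oA_low_degree: "a \<in> low_degree (Suc n) \<Longrightarrow> absC (oA a) \<le> real q ^ n"
  using q_ge_2 by (cases "a = 0") (auto simp: absC_oA low_degree_degree intro!: power_increasing)

text \<open>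
  Instead of the conjugates of \<open>e = b \<psi>\<^sub>n(f)\<close> one can look at multiplication by \<open>e\<close> on the space \<open>K(f)\<close>
  with its basis \<open>1, f, \<dots>, f^(r-1)\<close> and the maximum norm of the coordinates. Each factor \<open>f - a\<close> has
  operator norm at most \<open>max(B, |a|)\<close>, with \<open>B\<close> depending on \<open>f\<close> only, so multiplication by \<open>e\<close> has norm
  at most \<open>1/2\<close> for large \<open>n\<close>, and the coordinates of \<open>e^k\<close> tend to \<open>0\<close> as \<open>k\<close> grows. But \<open>e\<close> is integral
  over \<open>A\<close>, so the coordinates of all \<open>e^k\<close> have a common denominator \<open>w\<close>, and a nonzero element of
  \<open>(1/w) A\<close> has absolute value at least \<open>1/|w|\<close>. Hence \<open>e^k = 0\<close> for some \<open>k\<close>, so \<open>\<psi>\<^sub>n(f) = 0\<close>.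
\<close>
lemma integral_psi_imp_A:
  assumes p0: "p0 \<noteq> 0" "\<And>i. Polynomial.coeff p0 i \<in> K_in_C \<iota>" "poly p0 f = 0"
    and b: "b \<noteq> 0" and int: "\<And>n. oA b * psi n f \<in> Abar \<iota>"
  shows "f \<in> range oA"
proof -
  let ?K = "K_in_C \<iota>"
  let ?ann = "\<lambda>p. p \<noteq> 0 \<and> (\<forall>i. Polynomial.coeff p i \<in> ?K) \<and> poly p f = 0"
  obtain p where p: "?ann p" and min: "\<And>p'. ?ann p' \<Longrightarrow> Polynomial.degree p \<le> Polynomial.degree p'"
    using ex_has_least_nat[of ?ann p0 Polynomial.degree] p0 by blast
  define r where "r = Polynomial.degree p"
  have "r \<noteq> 0"
  proof
    assume "r = 0"
    then obtain c where "p = [:c:]" unfolding r_def by (auto elim: degree_eq_zeroE)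
    with p show False by auto
  qed
  then obtain r' where r': "r = Suc r'" by (cases r) auto
  have lc: "Polynomial.coeff p r \<noteq> 0" using p by (simp add: r_def)

  define \<kappa> where "\<kappa> j = - Polynomial.coeff p j / Polynomial.coeff p r" for j
  have \<kappa>K: "\<kappa> j \<in> ?K" for j
    unfolding \<kappa>_def using p by (intro K_divide K_closed(5)) auto
  have fr: "f ^ r = (\<Sum>j<r. \<kappa> j * f ^ j)"
  proof -
    have "0 = (\<Sum>j<r. Polynomial.coeff p j * f ^ j) + Polynomial.coeff p r * f ^ r"
      using p by (simp add: poly_altdef r_def lessThan_Suc_atMost[symmetric])
    then have "Polynomial.coeff p r * f ^ r = - (\<Sum>j<r. Polynomial.coeff p j * f ^ j)"
      by (simp add: add_eq_0_iff)
    then have "f ^ r = - (\<Sum>j<r. Polynomial.coeff p j * f ^ j) / Polynomial.coeff p r"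
      using lc by (metis nonzero_mult_div_cancel_left)
    then show ?thesis by (simp add: \<kappa>_def sum_divide_distrib sum_negf)
  qed

  have indep: "c j = c' j"
    if "\<And>j. c j \<in> ?K" "\<And>j. c' j \<in> ?K" "(\<Sum>j<r. c j * f ^ j) = (\<Sum>j<r. c' j * f ^ j)" "j < r"
    for c c' j
  proof -
    define s where "s = (\<Sum>j<r. Polynomial.monom (c j - c' j) j)"
    have co: "Polynomial.coeff s i = (if i < r then c i - c' i else 0)" for i
      by (simp add: s_def coeff_sum coeff_monom)
    have "s = 0"
    proof (rule ccontr)
      assume "s \<noteq> 0"
      moreover have "poly s f = 0"
        using that by (simp add: s_def poly_sum poly_monom left_diff_distrib sum_subtractf)
      moreover have "Polynomial.coeff s i \<in> ?K" for i
        using that by (auto simp: co intro: K_closed)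
      ultimately have "r \<le> Polynomial.degree s" using min r_def by blast
      then have "Polynomial.coeff s (Polynomial.degree s) = 0" by (simp add: co)
      then show False using \<open>s \<noteq> 0\<close> by simp
    qed
    then show ?thesis using co[of j] that by simp
  qed

  define B where "B = 1 + (\<Sum>j<r. absC (\<kappa> j))"
  have B1: "B \<ge> 1" by (simp add: B_def sum_nonneg absC_nonneg)
  have B\<kappa>: "absC (\<kappa> j) \<le> B" if "j < r" for j
    using member_le_sum[of j "{..<r}" "\<lambda>j. absC (\<kappa> j)"] that by (simp add: B_def absC_nonneg)

  \<comment> \<open>\<open>x\<close> has norm at most \<open>R\<close> with respect to the basis of powers of \<open>f\<close>.\<close>
  define rep where "rep R x \<longleftrightarrow>
      (\<exists>c. (\<forall>j. c j \<in> ?K) \<and> (\<forall>j<r. absC (c j) \<le> R) \<and> x = (\<Sum>j<r. c j * f ^ j))" for R x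
  have rep_mono: "rep R x \<Longrightarrow> R \<le> R' \<Longrightarrow> rep R' x" for R R' x
    unfolding rep_def by (elim exE conjE, rule exI) (auto intro: order_trans)
  have rep_nonneg: "rep R x \<Longrightarrow> R \<ge> 0" for R x
    unfolding rep_def using r' absC_nonneg by (meson lessI order_trans)
  have rep_scale: "rep (absC k * R) (k * x)" if "rep R x" "k \<in> ?K" for R x k
  proof -
    obtain c where c: "\<And>j. c j \<in> ?K" "\<And>j. j < r \<Longrightarrow> absC (c j) \<le> R" "x = (\<Sum>j<r. c j * f ^ j)"
      using \<open>rep R x\<close> unfolding rep_def by blast
    show ?thesis
      unfolding rep_def
      by (rule exI[of _ "\<lambda>j. k * c j"])
         (use c that in \<open>auto intro: K_closed simp: absC_mult absC_nonneg mult_left_mono sum_distrib_left mult.assoc\<close>)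
  qed
  have rep_diff: "rep (max R R') (x - y)" if "rep R x" "rep R' y" for R R' x y
  proof -
    obtain c where c: "\<And>j. c j \<in> ?K" "\<And>j. j < r \<Longrightarrow> absC (c j) \<le> R" "x = (\<Sum>j<r. c j * f ^ j)"
      using \<open>rep R x\<close> unfolding rep_def by blast
    obtain c' where c': "\<And>j. c' j \<in> ?K" "\<And>j. j < r \<Longrightarrow> absC (c' j) \<le> R'" "y = (\<Sum>j<r. c' j * f ^ j)"
      using \<open>rep R' y\<close> unfolding rep_def by blast
    have "absC (c j - c' j) \<le> max R R'" if "j < r" for j
      using absC_diff_le[of "c j" "c' j"] c(2)[OF that] c'(2)[OF that] by linarith
    then show ?thesis
      unfolding rep_def
      by (intro exI[of _ "\<lambda>j. c j - c' j"])
         (use c c' in \<open>auto intro: K_closed simp: left_diff_distrib sum_subtractf\<close>)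
  qed
  have rep_f: "rep (B * R) (f * x)" if "rep R x" for R x
  proof -
    obtain c where c: "\<And>j. c j \<in> ?K" "\<And>j. j < r \<Longrightarrow> absC (c j) \<le> R" "x = (\<Sum>j<r. c j * f ^ j)"
      using \<open>rep R x\<close> unfolding rep_def by blast
    have R: "R \<ge> 0" using rep_nonneg that by blast
    define c' where "c' j = (if j = 0 then 0 else c (j - 1)) + c r' * \<kappa> j" for j
    have "f * x = (\<Sum>j<r'. c j * f ^ Suc j) + c r' * f ^ r"
      by (simp add: c(3) r' sum_distrib_left algebra_simps)
    also have "(\<Sum>j<r'. c j * f ^ Suc j) = (\<Sum>j<r. (if j = 0 then 0 else c (j - 1)) * f ^ j)"
      unfolding r' by (subst sum.lessThan_Suc_shift) simp
    also have "\<dots> + c r' * f ^ r = (\<Sum>j<r. c' j * f ^ j)"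
      unfolding fr by (simp add: c'_def distrib_right sum.distrib sum_distrib_left mult.assoc)
    finally have "f * x = (\<Sum>j<r. c' j * f ^ j)" .
    moreover have "c' j \<in> ?K" for j
      unfolding c'_def using c \<kappa>K by (auto intro!: K_closed)
    moreover have "absC (c' j) \<le> B * R" if "j < r" for j
    proof -
      have "absC (c r' * \<kappa> j) \<le> R * B"
        unfolding absC_mult using c(2)[of r'] B\<kappa>[OF that] R by (intro mult_mono) (auto simp: r' absC_nonneg)
      moreover have "absC (if j = 0 then 0 else c (j - 1)) \<le> R"
        using c(2)[of "j - 1"] that R by auto
      moreover have "R \<le> B * R" using B1 R by (simp add: mult_le_cancel_right1)
      ultimately show ?thesis
        unfolding c'_def using absC_ultrametric[of "if j = 0 then 0 else c (j - 1)" "c r' * \<kappa> j"]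
        by (simp add: mult.commute)
    qed
    ultimately show ?thesis unfolding rep_def by blast
  qed
  have rep_prod: "rep (C ^ card S * R) ((\<Prod>a\<in>S. f - oA a) * x)"
    if "finite S" "rep R x" "B \<le> C" "\<And>a. a \<in> S \<Longrightarrow> absC (oA a) \<le> C" for C S R x
    using that(1,4)
  proof (induction S)
    case empty
    then show ?case using that by simp
  next
    case (insert a S)
    let ?y = "(\<Prod>a\<in>S. f - oA a) * x" and ?R = "C ^ card S * R"
    have y: "rep ?R ?y" using insert by auto
    have "?R \<ge> 0" using rep_nonneg y by blast
    then have "max (B * ?R) (absC (oA a) * ?R) \<le> C * ?R"
      using insert that(3) by (auto intro!: mult_right_mono)
    then have "rep (C * ?R) (f * ?y - oA a * ?y)"
      using rep_mono rep_diff[OF rep_f[OF y] rep_scale[OF y oA_in_K]] by blast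
    then show ?case using insert by (simp add: algebra_simps)
  qed

  \<comment> \<open>\<open>n\<close> is chosen so large that \<open>B \<le> q^(n-1)\<close>, which makes \<open>q^(n-1)\<close> a bound for every factor, and that
    \<open>|b| q^((n-1) q^n) / |D\<^sub>n| = |b| q^(-q^n)\<close> is at most \<open>1/2\<close>.\<close>
  obtain n1 where n1: "B < 2 ^ n1" using real_arch_pow[of 2 B] by auto
  obtain n2 where n2: "2 * absC (oA b) < 2 ^ n2" using real_arch_pow[of 2 "2 * absC (oA b)"] by auto
  define n' where "n' = n1 + n2"
  define n where "n = Suc n'"
  define e where "e = oA b * psi n f"
  have q2: "real q \<ge> 2" using q_ge_2 by simp
  have BC: "B \<le> real q ^ n'"
  proof -
    have "(2 :: real) ^ n1 \<le> 2 ^ n'" by (simp add: n'_def)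
    also have "\<dots> \<le> real q ^ n'" using q2 by (intro power_mono) auto
    finally show ?thesis using n1 by simp
  qed
  have small: "absC (oA b / DC n) * (real q ^ n') ^ (q ^ n) \<le> 1 / 2"
  proof -
    have "absC (oA b / DC n) * (real q ^ n') ^ (q ^ n) = absC (oA b) * (real q ^ n' / real q ^ n) ^ (q ^ n)"
      by (simp add: absC_divide absC_DC power_divide)
    also have "real q ^ n' / real q ^ n = 1 / real q"
      by (simp add: n_def)
    also have "(1 / real q) ^ (q ^ n) \<le> (1 / 2) ^ (q ^ n)"
      using q2 by (intro power_mono) (auto simp: field_simps)
    also have "(1 / 2 :: real) ^ (q ^ n) \<le> (1 / 2) ^ n2"
      using less_q_power[of n] by (intro power_decreasing) (auto simp: n_def n'_def)
    also have "absC (oA b) * (1 / 2) ^ n2 \<le> 1 / 2"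
      using n2 by (simp add: field_simps power_divide)
    finally show ?thesis using absC_nonneg by (simp add: mult_left_mono)
  qed
  have rep_e: "rep ((1 / 2) * R) (e * x)" if "rep R x" for R x
  proof -
    have "rep ((real q ^ n') ^ (q ^ n) * R) ((\<Prod>a\<in>low_degree n. f - oA a) * x)"
      using rep_prod[OF finite_low_degree[of n] that BC] absC_oA_low_degree card_low_degree[of n]
      by (simp add: n_def)
    then have "rep (absC (oA b / DC n) * ((real q ^ n') ^ (q ^ n) * R))
       (oA b / DC n * ((\<Prod>a\<in>low_degree n. f - oA a) * x))"
      by (rule rep_scale) (intro K_divide oA_in_K)
    moreover have "oA b / DC n * ((\<Prod>a\<in>low_degree n. f - oA a) * x) = e * x"
      by (simp add: e_def psi_factorization)
    moreover have "absC (oA b / DC n) * ((real q ^ n') ^ (q ^ n) * R) \<le> 1 / 2 * R"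
      using mult_right_mono[OF small rep_nonneg[OF that]] by (simp add: mult.assoc)
    ultimately show ?thesis using rep_mono by metis
  qed
  have "rep 1 1"
    unfolding rep_def
    by (rule exI[of _ "\<lambda>j. if j = 0 then 1 else 0"])
       (auto simp: r' K_closed mult_delta_left)
  then have rep_power: "rep ((1 / 2) ^ k) (e ^ k)" for k
    using rep_e by (induction k) auto

  \<comment> \<open>\<open>x\<close> has coordinates in \<open>(1/w) A\<close>.\<close>
  define lat where "lat w x \<longleftrightarrow>
      (\<exists>c. (\<forall>j. oA w * c j \<in> range oA) \<and> x = (\<Sum>j<r. c j * f ^ j))" for w x
  have lat_mult: "lat (v * w) x" if "lat w x" for v w x
  proof -
    obtain c where c: "\<And>j. oA w * c j \<in> range oA" "x = (\<Sum>j<r. c j * f ^ j)"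
      using \<open>lat w x\<close> unfolding lat_def by blast
    have "oA (v * w) * c j \<in> range oA" for j
      using A_closed(4)[OF rangeI[of _ v] c(1)[of j]] by (simp add: oA_mult mult.assoc)
    then show ?thesis unfolding lat_def using c by blast
  qed
  have lat_add: "lat w (x + y)" if "lat w x" "lat w y" for w x y
  proof -
    obtain c where c: "\<And>j. oA w * c j \<in> range oA" "x = (\<Sum>j<r. c j * f ^ j)"
      using \<open>lat w x\<close> unfolding lat_def by blast
    obtain c' where c': "\<And>j. oA w * c' j \<in> range oA" "y = (\<Sum>j<r. c' j * f ^ j)"
      using \<open>lat w y\<close> unfolding lat_def by blast
    have "oA w * (c j + c' j) \<in> range oA" for j
      using A_closed(6)[OF c(1)[of j] c'(1)[of j]] by (simp add: distrib_left)
    then show ?thesis unfolding lat_def using c c'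
      by (intro exI[of _ "\<lambda>j. c j + c' j"]) (auto simp: distrib_right sum.distrib)
  qed
  have lat_scale: "lat w (k * x)" if "lat w x" "k \<in> range oA" for w x k
  proof -
    obtain c where c: "\<And>j. oA w * c j \<in> range oA" "x = (\<Sum>j<r. c j * f ^ j)"
      using \<open>lat w x\<close> unfolding lat_def by blast
    have "oA w * (k * c j) \<in> range oA" for j
      using A_closed(4)[OF that(2) c(1)[of j]] by (simp add: mult.left_commute)
    then show ?thesis unfolding lat_def using c
      by (intro exI[of _ "\<lambda>j. k * c j"]) (auto simp: sum_distrib_left mult.assoc)
  qed
  have lat_0: "lat w 0" for w
    unfolding lat_def using A_closed(1) by (intro exI[of _ "\<lambda>j. 0"]) auto
  have lat_sum: "lat w (\<Sum>i\<in>I. g i)" if "finite I" "\<And>i. i \<in> I \<Longrightarrow> lat w (g i)" for w I and g :: "nat \<Rightarrow> 'c"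
    using that by (induction I) (auto intro: lat_add lat_0)
  have lat_ex: "\<exists>w. w \<noteq> 0 \<and> lat w x" if x: "rep R x" for R x
  proof -
    obtain c where c: "\<And>j. c j \<in> ?K" "x = (\<Sum>j<r. c j * f ^ j)"
      using x unfolding rep_def by blast
    have "\<exists>w. w \<noteq> 0 \<and> lat w (c j * f ^ j)" if "j < r" for j
    proof -
      obtain u v where uv: "c j = oA u / oA v" "v \<noteq> 0" using c(1)[of j] by (auto simp: K_in_C_def)
      have "lat v (c j * f ^ j)"
        unfolding lat_def
        by (rule exI[of _ "\<lambda>i. if i = j then c j else 0"])
           (use uv that A_closed(1) in \<open>auto simp: mult_delta_left\<close>)
      then show ?thesis using uv by blast
    qed
    then obtain w where w: "\<And>j. j < r \<Longrightarrow> w j \<noteq> 0 \<and> lat (w j) (c j * f ^ j)" by metis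
    have "lat (\<Prod>j<r. w j) (c j * f ^ j)" if "j < r" for j
      using lat_mult[of "w j" _ "\<Prod>j\<in>{..<r} - {j}. w j"] w[OF that] prod.remove[of "{..<r}" j w] that
      by (simp add: mult.commute)
    then have "lat (\<Prod>j<r. w j) x" unfolding c(2) by (intro lat_sum) auto
    moreover have "(\<Prod>j<r. w j) \<noteq> 0" using w by simp
    ultimately show ?thesis by blast
  qed

  obtain g where g: "Polynomial.lead_coeff g = 1" "\<And>i. Polynomial.coeff g i \<in> range oA" "poly g e = 0"
    using int[of n] unfolding e_def[symmetric] Abar_def by blast
  define t where "t = Polynomial.degree g"
  have et: "e ^ t = (\<Sum>i<t. - Polynomial.coeff g i * e ^ i)"
  proof -
    have "0 = (\<Sum>i<t. Polynomial.coeff g i * e ^ i) + e ^ t"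
      using g by (simp add: poly_altdef t_def lessThan_Suc_atMost[symmetric])
    then show ?thesis by (simp add: add_eq_0_iff sum_negf)
  qed
  \<comment> \<open>A common denominator for the powers of \<open>e\<close> below the degree of an integral equation of \<open>e\<close> serves
    for all powers.\<close>
  obtain w where w: "w \<noteq> 0" "\<And>k. k < t \<Longrightarrow> lat w (e ^ k)"
  proof -
    have "\<exists>w. w \<noteq> 0 \<and> lat w (e ^ k)" for k using lat_ex rep_power by blast
    then obtain w where w: "\<And>k. w k \<noteq> 0 \<and> lat (w k) (e ^ k)" by metis
    have "lat (\<Prod>j<t. w j) (e ^ k)" if "k < t" for k
      using lat_mult[of "w k" _ "\<Prod>j\<in>{..<t} - {k}. w j"] w[of k] prod.remove[of "{..<t}" k w] that
      by (simp add: mult.commute)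
    moreover have "(\<Prod>j<t. w j) \<noteq> 0" using w by simp
    ultimately show ?thesis using that by blast
  qed
  have lat_power: "lat w (e ^ k)" for k
  proof (induction k rule: less_induct)
    case (less k)
    show ?case
    proof (cases "k < t")
      case False
      then have "e ^ k = e ^ (k - t) * e ^ t" by (simp flip: power_add)
      also have "\<dots> = (\<Sum>i<t. - Polynomial.coeff g i * e ^ (k - t + i))"
        unfolding et by (simp add: sum_distrib_left power_add algebra_simps)
      also have "lat w \<dots>"
        using less False g(2) by (intro lat_sum lat_scale A_closed(5)) auto
      finally show ?thesis .
    qed (use w in auto)
  qed

  have W: "absC (oA w) > 0" using w by (intro absC_pos) simp
  obtain k where k: "absC (oA w) < 2 ^ k" using real_arch_pow[of 2 "absC (oA w)"] by auto
  obtain c where c: "\<And>j. oA w * c j \<in> range oA" "e ^ k = (\<Sum>j<r. c j * f ^ j)"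
    using lat_power[of k] unfolding lat_def by blast
  obtain c' where c': "\<And>j. c' j \<in> ?K" "\<And>j. j < r \<Longrightarrow> absC (c' j) \<le> (1 / 2) ^ k" "e ^ k = (\<Sum>j<r. c' j * f ^ j)"
    using rep_power[of k] unfolding rep_def by blast
  have "c j \<in> ?K" for j
  proof -
    obtain u where "oA w * c j = oA u" using c(1)[of j] by blast
    then have "c j = oA u / oA w" using w by (simp add: field_simps)
    then show ?thesis using K_in_C_I w by simp
  qed
  then have eq: "c j = c' j" if "j < r" for j
    using indep[of c c' j] c c' that by simp
  have "c j = 0" if j: "j < r" for j
  proof -
    obtain u where u: "oA w * c j = oA u" using c(1)[of j] by blast
    have "absC (oA w * c j) \<le> absC (oA w) * (1 / 2) ^ k"
      unfolding absC_mult eq[OF j] using c'(2)[OF j] absC_nonneg by (intro mult_left_mono) auto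
    also have "\<dots> < 1" using k by (simp add: power_divide)
    finally have "absC (oA u) < 1" by (simp add: u)
    moreover have "absC (oA u) \<ge> 1" if "u \<noteq> 0"
      using that q_ge_2 by (simp add: absC_oA one_le_power)
    ultimately have "u = 0" by force
    then show ?thesis using u w by simp
  qed
  then have "e ^ k = 0" using c by simp
  then have "psi n f = 0" using b by (simp add: e_def)
  then show ?thesis by (auto simp: psi_factorization)
qed

lemma Abar_iff:
  "x \<in> Abar \<iota> \<longleftrightarrow> (\<exists>p. Polynomial.lead_coeff p = 1 \<and> (\<forall>i. Polynomial.coeff p i \<in> range oA) \<and> poly p x = 0)"
  (is "_ \<longleftrightarrow> (\<exists>p. ?P p)")
proof
  assume "\<exists>p. ?P p"
  then obtain p where p: "?P p" by blast
  have "Polynomial.coeff p i \<in> K_in_C \<iota>" for i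
  proof -
    obtain a where "Polynomial.coeff p i = oA a" using p by blast
    then show ?thesis using oA_in_K by simp
  qed
  moreover have "p \<noteq> 0" using p by auto
  ultimately show "x \<in> Abar \<iota>" using p unfolding Abar_def Kbar_def by blast
qed (auto simp: Abar_def)

lemma coeff_pcompose_in_subring:
  fixes R :: "'c set"
  assumes R: "is_subring R" and "\<And>i. Polynomial.coeff p i \<in> R" "\<And>i. Polynomial.coeff r i \<in> R"
  shows "Polynomial.coeff (pcompose p r) i \<in> R"
  using assms(2)
proof (induction p arbitrary: i)
  case 0
  then show ?case by (simp add: is_subring_closed[OF R])
next
  case (pCons c p)
  have c: "c \<in> R" using pCons.prems[of 0] by simp
  have "Polynomial.coeff p i \<in> R" for i using pCons.prems[of "Suc i"] by simp
  then have IH: "Polynomial.coeff (pcompose p r) i \<in> R" for i using pCons.IH by blast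
  have sum: "(\<Sum>j\<in>J. g j) \<in> R" if "\<And>j. j \<in> J \<Longrightarrow> g j \<in> R" for J :: "nat set" and g
    using that by (induction J rule: infinite_finite_induct) (auto simp: is_subring_closed[OF R])
  have "Polynomial.coeff (r * pcompose p r) i \<in> R"
    unfolding coeff_mult using IH assms(3) by (intro sum is_subring_closed(4)[OF R])
  moreover have "Polynomial.coeff [:c:] i \<in> R"
    using c by (cases i) (auto simp: is_subring_closed[OF R])
  ultimately show ?case
    by (simp add: pcompose_pCons is_subring_closed[OF R])
qed

lemma oA_in_Abar: "oA a \<in> Abar \<iota>"
proof -
  have "Polynomial.coeff [:- oA a, 1:] i \<in> range oA" for i
    using A_closed(5)[OF rangeI[of _ a]] A_closed(1,2)
    by (auto simp: coeff_pCons split: nat.splits)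
  then show ?thesis unfolding Abar_iff by (intro exI[of _ "[:- oA a, 1:]"]) auto
qed

lemma Abar_diff_oA:
  assumes "x \<in> Abar \<iota>"
  shows "x - oA a \<in> Abar \<iota>"
proof -
  obtain p where p: "Polynomial.lead_coeff p = 1" "\<And>i. Polynomial.coeff p i \<in> range oA" "poly p x = 0"
    using assms unfolding Abar_iff by blast
  let ?r = "[:oA a, 1:]"
  have "Polynomial.coeff ?r i \<in> range oA" for i
    using A_closed(1,2) by (auto simp: coeff_pCons split: nat.splits)
  then have "Polynomial.coeff (pcompose p ?r) i \<in> range oA" for i
    by (intro coeff_pcompose_in_subring is_subring_range_oA p)
  moreover have "Polynomial.lead_coeff (pcompose p ?r) = 1"
    using p by (subst lead_coeff_comp) auto
  moreover have "poly (pcompose p ?r) (x - oA a) = 0"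
    using p by (simp add: poly_pcompose)
  ultimately show ?thesis unfolding Abar_iff by blast
qed

lemma carlitz_L_in_tensor_iff:
  "carlitz_L \<iota> F \<in> Abar_fps_tensor_K \<iota> s \<longleftrightarrow>
    (\<exists>b. b \<noteq> 0 \<and> (\<forall>n. mconst (oA b) * L_coeff F n \<in> mpolys (Abar \<iota>) s))"
proof -
  have 0: "0 \<in> mpolys (Abar \<iota>) s"
    using oA_in_Abar[of 0] by (simp add: mpolys_def)
  have "(\<forall>N. fps_nth (fps_const (mconst (oA b)) * carlitz_L \<iota> F) N \<in> mpolys (Abar \<iota>) s) \<longleftrightarrow>
        (\<forall>n. mconst (oA b) * L_coeff F n \<in> mpolys (Abar \<iota>) s)" (is "?l \<longleftrightarrow> ?r") for b
  proof
    show "?l \<Longrightarrow> ?r" by (metis carlitz_L_nth_q_power fps_mult_left_const_nth)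
    show "?l" if "?r"
    proof
      fix N
      show "fps_nth (fps_const (mconst (oA b)) * carlitz_L \<iota> F) N \<in> mpolys (Abar \<iota>) s"
        using that 0 carlitz_L_nth_q_power carlitz_L_nth_other[of N F]
        by (cases "\<exists>n. N = q ^ n") auto
    qed
  qed
  then show ?thesis unfolding Abar_fps_tensor_K_def by simp
qed

text \<open>
  Induction on the number of monomials. The leading coefficient \<open>f\<close> is algebraic over \<open>K\<close> since
  \<open>b \<psi>\<^sub>0(f) = b f\<close> is integral over \<open>A\<close>, and it lies in \<open>A\<close> since all \<open>b \<psi>\<^sub>n(f)\<close> are integral. When
  \<open>f X^m\<close> is removed, \<open>b E\<^sub>n\<close> changes by a polynomial over \<open>A\<close>, and thus stays integral.
\<close>
lemma integral_L_coeffs_imp_A: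
  assumes "F \<in> mpolys UNIV s" "b \<noteq> 0" "\<And>n. mconst (oA b) * L_coeff F n \<in> mpolys (Abar \<iota>) s"
  shows "F \<in> mpolys (range oA) s"
  using assms(1,3)
proof (induction "card (Poly_Mapping.keys F)" arbitrary: F rule: less_induct)
  case less
  show ?case
  proof (cases "F = 0")
    case True
    then show ?thesis by (simp add: mpolys_0 is_subring_range_oA)
  next
    case False
    then have "Poly_Mapping.keys F \<noteq> {}" by (auto simp: poly_mapping_eq_iff fun_eq_iff keys.rep_eq)
    then have "Max (total_degree ` Poly_Mapping.keys F) \<in> total_degree ` Poly_Mapping.keys F"
      by (intro Max_in) auto
    then obtain m where m: "m \<in> Poly_Mapping.keys F"
      and "Max (total_degree ` Poly_Mapping.keys F) = total_degree m" by blast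
    then have max: "total_degree k \<le> total_degree m" if "k \<in> Poly_Mapping.keys F" for k
      using Max_ge[of "total_degree ` Poly_Mapping.keys F" "total_degree k"] that by simp
    let ?f = "Poly_Mapping.lookup F m"
    have int: "oA b * psi n ?f \<in> Abar \<iota>" for n
      using mpolys_lookup[OF less.prems(2)[of n], of "scale_monom (q ^ n) m"]
        lookup_L_coeff_leading[of F m n] max by (simp add: lookup_mconst_mult)
    obtain p where p: "Polynomial.lead_coeff p = 1" "\<And>i. Polynomial.coeff p i \<in> range oA" "poly p (oA b * ?f) = 0"
      using int[of 0] unfolding Abar_iff by auto
    let ?p = "pcompose p [:0, oA b:]"
    have "?f \<in> range oA"
    proof (rule integral_psi_imp_A[OF _ _ _ \<open>b \<noteq> 0\<close> int])
      have "Polynomial.lead_coeff ?p \<noteq> 0"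
        using p \<open>b \<noteq> 0\<close> by (subst lead_coeff_comp) auto
      then show "?p \<noteq> 0" by auto
      show "poly ?p ?f = 0" using p by (simp add: poly_pcompose mult.commute)
      have "Polynomial.coeff p i \<in> K_in_C \<iota>" for i using p(2)[of i] oA_in_K by auto
      moreover have "Polynomial.coeff [:0, oA b:] i \<in> K_in_C \<iota>" for i
        using oA_in_K[of b] oA_in_K[of 0] by (auto simp: coeff_pCons split: nat.splits)
      ultimately show "Polynomial.coeff ?p i \<in> K_in_C \<iota>" for i
        by (intro coeff_pcompose_in_subring is_subring_K)
    qed
    define T where "T = Poly_Mapping.single m ?f"
    have T: "T \<in> mpolys (range oA) s"
      unfolding T_def using \<open>?f \<in> range oA\<close> mpolys_keys[OF less.prems(1) m] A_closed(1)
      by (intro mpolys_single)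
    then have T_UNIV: "T \<in> mpolys UNIV s" using mpolys_mono[of "range oA" UNIV s] by blast
    have F': "F - T \<in> mpolys UNIV s"
      by (intro mpolys_diff is_subring_UNIV less.prems T_UNIV)
    have "Poly_Mapping.keys (F - T) = Poly_Mapping.keys F - {m}"
      by (auto simp: T_def in_keys_iff lookup_minus lookup_single when_def split: if_splits)
    then have "card (Poly_Mapping.keys (F - T)) < card (Poly_Mapping.keys F)"
      using m by (metis card_Diff1_less finite_keys)
    moreover have "mconst (oA b) * L_coeff (F - T) n \<in> mpolys (Abar \<iota>) s" for n
    proof -
      have "L_coeff F n = L_coeff (F - T) n + L_coeff T n"
        using L_coeff_add[of "F - T" T n] by simp
      then have eq: "mconst (oA b) * L_coeff (F - T) n = mconst (oA b) * L_coeff F n - mconst (oA b) * L_coeff T n"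
        by (simp add: algebra_simps)
      have "mconst (oA b) * L_coeff T n \<in> mpolys (range oA) s"
        by (intro mpolys_mconst_mult L_coeff_integral T is_subring_range_oA rangeI)
      then have "Poly_Mapping.lookup (mconst (oA b) * L_coeff (F - T) n) k \<in> Abar \<iota>" for k
        using mpolys_lookup[OF less.prems(2)[of n], of k] Abar_diff_oA
        unfolding eq lookup_minus by (auto dest!: mpolys_lookup[of _ _ _ k])
      moreover have "mconst (oA b) * L_coeff (F - T) n \<in> mpolys UNIV s"
        by (intro mpolys_mconst_mult L_coeff_UNIV F' is_subring_UNIV UNIV_I)
      ultimately show ?thesis by (simp add: mpolys_def)
    qed
    ultimately have "F - T \<in> mpolys (range oA) s" using less.hyps F' by blast
    then have "F - T + T \<in> mpolys (range oA) s"
      using T by (intro mpolys_add is_subring_range_oA)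
    then show ?thesis by simp
  qed
qed

lemma carlitz_L_in_tensor_eq_A_polys:
  "{F \<in> mpolys UNIV s. carlitz_L \<iota> F \<in> Abar_fps_tensor_K \<iota> s} = mpolys (range oA) s"
proof (intro equalityI subsetI)
  fix F assume "F \<in> {F \<in> mpolys UNIV s. carlitz_L \<iota> F \<in> Abar_fps_tensor_K \<iota> s}"
  then show "F \<in> mpolys (range oA) s"
    unfolding carlitz_L_in_tensor_iff using integral_L_coeffs_imp_A by blast
next
  fix F assume F: "F \<in> mpolys (range oA) s"
  have "mpolys (range oA) s \<subseteq> mpolys (Abar \<iota>) s"
    using oA_in_Abar by (intro mpolys_mono) auto
  then have "mconst (oA 1) * L_coeff F n \<in> mpolys (Abar \<iota>) s" for n
    using L_coeff_integral[OF F, of n] by auto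
  then have "carlitz_L \<iota> F \<in> Abar_fps_tensor_K \<iota> s"
    unfolding carlitz_L_in_tensor_iff using zero_neq_one by metis
  moreover have "F \<in> mpolys UNIV s" using F mpolys_mono[of "range oA" UNIV s] by blast
  ultimately show "F \<in> {F \<in> mpolys UNIV s. carlitz_L \<iota> F \<in> Abar_fps_tensor_K \<iota> s}" by simp
qed

end

theorem proposition4p17:
  fixes absC :: "'c::field \<Rightarrow> real"
    and \<iota> :: "'q::finite_field fls alg_closure \<Rightarrow> 'c"
    and s :: nat
  assumes "carlitz_complex absC \<iota>"
    and "s \<ge> 1"
  shows "{F \<in> mpolys UNIV s. carlitz_L \<iota> F \<in> Abar_fps_tensor_K \<iota> s} =
         mpolys (range (of_A \<iota>)) s"
proof -
  interpret carlitz_complex_q absC \<iota> "CARD('q)"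
    using assms(1) by (simp add: carlitz_complex_q_def carlitz_complex_q_axioms_def)
  show ?thesis by (rule carlitz_L_in_tensor_eq_A_polys)
qed

end
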